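(* Let $G_1=\langle (1\;2\;3),t\rangle$ and $G_2=\langle(1\;2\;3),t^2\rangle$, as subgroups of $\mathrm{Sym}(\mathbb{Z})$. Then $u(G_1)\ge 2$, $u(G_2)\ge 2$, $s(G_1)\le 9$, and $s(G_2)\le 9$.
   Context: $\mathrm{Sym}(\mathbb{Z})$ is the group of all bijections of $\mathbb{Z}$, acting on the right (so products are composed left to right), and $t\in\mathrm{Sym}(\mathbb{Z})$ is the translation $z\mapsto z+1$; $(1\;2\;3)$ denotes the 3-cycle on $1,2,3$ fixing all other integers. For a group $G$ and a subset $X\subseteq G$, the spread on $X$, denoted $s_X(G)$, is the supremum of those $k\in\{0,1,2,\ldots\}$ such that for any $g_1,\ldots,g_k\in G\setminus\{1\}$ there exists $h\in X$ with $\langle g_1,h\rangle=\cdots=\langle g_k,h\rangle=G$. The spread of $G$ is $s(G):=s_G(G)$. The uniform spread of $G$ is $u(G):=\sup\{s_C(G): C \text{ a conjugacy class of } G\}$. *)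

theory Defs
  imports "HOL-Combinatorics.Cycles" "HOL-Library.Extended_Nat" "HOL-Algebra.Generated_Groups" "HOL-Algebra.Bij"
begin

section \<open>Spread and uniform spread of a group\<close>

text \<open>
  Suprema are taken in \<^typ>\<open>enat\<close>: the spread may be infinite. The functions \<open>g\<close> below encode
  tuples \<open>g 0, \<dots>, g (k - 1)\<close>, whose entries need not be distinct. For \<open>k = 0\<close> the condition just
  says that \<open>X\<close> is nonempty.
\<close>

definition spread_on :: "('a, 'b) monoid_scheme \<Rightarrow> 'a set \<Rightarrow> enat" where
  "spread_on G X = Sup {enat k | k.
     \<forall>g :: nat \<Rightarrow> 'a. (\<forall>i<k. g i \<in> carrier G - {\<one>\<^bsub>G\<^esub>}) \<longrightarrow>
       (\<exists>h\<in>X. \<forall>i<k. generate G {g i, h} = carrier G)}"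

definition spread :: "('a, 'b) monoid_scheme \<Rightarrow> enat" where
  "spread G = spread_on G (carrier G)"

definition conjugacy_class :: "('a, 'b) monoid_scheme \<Rightarrow> 'a \<Rightarrow> 'a set" where
  "conjugacy_class G g = {inv\<^bsub>G\<^esub> x \<otimes>\<^bsub>G\<^esub> g \<otimes>\<^bsub>G\<^esub> x | x. x \<in> carrier G}"

definition uniform_spread :: "('a, 'b) monoid_scheme \<Rightarrow> enat" where
  "uniform_spread G = Sup {spread_on G (conjugacy_class G g) | g. g \<in> carrier G}"


section \<open>The symmetric group on the integers\<close>

text \<open>
  Permutations act on the right, so \<open>f \<otimes> g\<close> is \<open>f\<close> followed by \<open>g\<close>. This is the opposite of the
  convention of \<^const>\<open>BijGroup\<close>.
\<close>

definition SymZ :: "(int \<Rightarrow> int) monoid" where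
  "SymZ = \<lparr>carrier = {f. bij f}, mult = (\<lambda>f g. g \<circ> f), one = id\<rparr>"

lemma group_SymZ: "group SymZ"
proof (rule groupI)
  fix f assume "f \<in> carrier SymZ"
  then show "\<exists>g\<in>carrier SymZ. g \<otimes>\<^bsub>SymZ\<^esub> f = \<one>\<^bsub>SymZ\<^esub>"
    by (intro bexI[of _ "inv_into UNIV f"])
      (simp_all add: SymZ_def bij_imp_bij_inv surj_iff[THEN iffD1, OF bij_is_surj])
qed (auto simp: SymZ_def bij_comp comp_assoc)

definition translation :: "int \<Rightarrow> int" where
  "translation = (\<lambda>z. z + 1)"

lemma translation_in_SymZ: "translation \<in> carrier SymZ"
  by (auto simp: SymZ_def translation_def bij_def inj_def surj_def intro: exI[of _ "_ - 1"])

definition cycle123 :: "int \<Rightarrow> int" where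
  "cycle123 = cycle_of_list [1, 2, 3]"

lemma cycle123_apply:
  "cycle123 z = (if z = 1 then 2 else if z = 2 then 3 else if z = 3 then 1 else z)"
  by (simp add: cycle123_def transpose_def)

lemma cycle123_in_SymZ: "cycle123 \<in> carrier SymZ"
  using permutes_bij[OF cycle_permutes[of "[1, 2, 3 :: int]"]]
  unfolding SymZ_def cycle123_def by simp

text \<open>
  \<^const>\<open>subgroup_generated\<close> intersects its generating set with the carrier, which has no effect
  here, as both generators are bijections.
\<close>

definition G1 :: "(int \<Rightarrow> int) monoid" where
  "G1 = subgroup_generated SymZ {cycle123, translation}"

definition G2 :: "(int \<Rightarrow> int) monoid" where
  "G2 = subgroup_generated SymZ {cycle123, translation [^]\<^bsub>SymZ\<^esub> (2::nat)}"

end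

theory Submission
  imports Defs
begin

text \<open>
  Both groups have the form \<open>G = \<langle>(1 2 3), t\<^sup>n\<rangle>\<close> with \<open>n \<in> {1, 2}\<close>. Such a group contains every
  three-cycle, and each of its elements is an even permutation of finite support followed by a
  translation by some multiple \<open>k\<close> of \<open>n\<close>.

  \<^bold>\<open>Lower bound.\<close> The conjugacy class of \<open>t\<^sup>n\<close> works. Given nontrivial \<open>g\<^sub>1, g\<^sub>2 \<in> G\<close>, it
  suffices to find one \<open>y \<in> G\<close> such that for both \<open>i\<close> the element \<open>g\<^sub>i\<close>, relabelled by \<open>y\<close>,
  generates \<open>G\<close> together with \<open>t\<^sup>n\<close>: undoing the relabelling turns \<open>t\<^sup>n\<close> into the required common
  mate. Composing the relabelled \<open>g\<^sub>i\<close> with a power of \<open>t\<^sup>n\<close> gives a permutation \<open>h\<close> of finite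
  support, so one has to see when \<open>h\<close> and \<open>t\<^sup>n\<close> generate all three-cycles.

  This is a concrete form of Jordan's theorem that a primitive group with a three-cycle contains
  the alternating group. Call two points linked if some three-cycle in the group moves both; this
  is an invariant equivalence relation, and if it is total then all three-cycles are present.
  A three-cycle arises as the commutator of \<open>h\<close> with a translate of \<open>h\<close> whose support meets that
  of \<open>h\<close> in a single point (\<open>commutator_cyc3\<close>). Two of the three points have the same parity, and
  since the group contains \<open>t\<^sup>2\<close> some classes are unbounded. A permutation of finite support
  cannot move an unbounded class, as it fixes almost all of its points. So linkedness is total as
  soon as \<open>h\<close> moves some even point by exactly \<open>2\<close> and sends some even point to an odd one
  (\<open>linked_all_if_steps\<close>).

  The group is highly transitive, so \<open>y\<close> may be prescribed on any finite set, and it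
  remains to place finitely many points so that both elements acquire such steps (\<open>prepared_pair\<close>).
  Two pairs of points, overlapping or not, can always be placed at distance \<open>2\<close> inside the even
  numbers. Here the parity of the permutations enters: an even \<open>g\<^sub>i\<close> of finite support is not a
  transposition, hence has an arrow that avoids the one moved point that is placed at an odd
  number. The commutator needs a shift \<open>d\<close> divisible by \<open>n\<close> for which the support of \<open>h\<close> meets its
  translate once. The distance between the extreme points of the support is such a \<open>d\<close> if it is
  even. If \<open>k = 0\<close> one uses the extreme even points, and the lone odd point does no harm; if
  \<open>k \<noteq> 0\<close> the extreme points are controlled by the extreme points moved by \<open>y\<close>.

  \<^bold>\<open>Upper bound.\<close> The ten three-cycles \<open>(a b c)\<close> with \<open>1 \<le> a < b < c \<le> 5\<close> have no common mate
  \<open>h\<close>. Indeed, any permutation \<open>h\<close> of the integers preserves some proper nonempty set \<open>X\<close> or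
  exchanges it with its complement: take an orbit of \<open>h\<close> or, if there is only one, an orbit of
  \<open>h\<^sup>2\<close>. Three of the five points lie on the same side of \<open>X\<close>, and then \<open>h\<close> and their three-cycle
  both preserve the partition into \<open>X\<close> and its complement, which \<open>G\<close> does not.
\<close>

section \<open>Translations and three-cycles\<close>

definition shift :: "int \<Rightarrow> int \<Rightarrow> int" where
  "shift k z = z + k"

definition cyc3 :: "int \<Rightarrow> int \<Rightarrow> int \<Rightarrow> int \<Rightarrow> int" where
  "cyc3 a b c z = (if z = a then b else if z = b then c else if z = c then a else z)"

abbreviation perm_inv :: "(int \<Rightarrow> int) \<Rightarrow> int \<Rightarrow> int" where
  "perm_inv f \<equiv> inv_into UNIV f"

lemma shift_comp: "shift k \<circ> shift l = shift (k + l)"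
  by (auto simp: shift_def fun_eq_iff)

lemma shift_0: "shift 0 = id"
  by (auto simp: shift_def fun_eq_iff)

lemma bij_shift: "bij (shift k)"
  by (rule o_bij[of "shift (- k)"]) (simp_all add: shift_comp shift_0)

lemma perm_inv_eqI:
  assumes "g \<circ> f = id" "f \<circ> g = id"
  shows "perm_inv f = g"
  using inv_unique_comp[OF assms(2,1)] by simp

lemma perm_inv_shift: "perm_inv (shift k) = shift (- k)"
  by (rule perm_inv_eqI) (simp_all add: shift_comp shift_0)

lemma bij_inv_apply: "bij f \<Longrightarrow> perm_inv f (f x) = x"
  by (simp add: bij_is_inj)

lemma bij_apply_inv: "bij f \<Longrightarrow> f (perm_inv f x) = x"
  by (simp add: bij_is_surj surj_f_inv_f)

lemma cyc3_comp_inverse: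
  assumes "distinct [a, b, c]"
  shows "cyc3 a b c \<circ> cyc3 a c b = id" "cyc3 a c b \<circ> cyc3 a b c = id"
  using assms by (auto simp: cyc3_def fun_eq_iff)

lemma bij_cyc3: "distinct [a, b, c] \<Longrightarrow> bij (cyc3 a b c)"
  using cyc3_comp_inverse o_bij by blast

lemma perm_inv_cyc3: "distinct [a, b, c] \<Longrightarrow> perm_inv (cyc3 a b c) = cyc3 a c b"
  using cyc3_comp_inverse by (intro perm_inv_eqI) auto

lemma cyc3_rotate: "distinct [a, b, c] \<Longrightarrow> cyc3 b c a = cyc3 a b c"
  by (auto simp: cyc3_def fun_eq_iff)

lemma cyc3_fixes: "z \<noteq> a \<Longrightarrow> z \<noteq> b \<Longrightarrow> z \<noteq> c \<Longrightarrow> cyc3 a b c z = z"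
  by (simp add: cyc3_def)

lemma conj_cyc3:
  assumes "bij f" "distinct [a, b, c]"
  shows "f \<circ> cyc3 a b c \<circ> perm_inv f = cyc3 (f a) (f b) (f c)"
proof
  fix z
  obtain w where z: "z = f w" using assms(1) by (metis bij_pointE)
  have inj: "f x = f y \<longleftrightarrow> x = y" for x y
    using assms(1) by (meson bij_is_inj injD)
  show "(f \<circ> cyc3 a b c \<circ> perm_inv f) z = cyc3 (f a) (f b) (f c) z"
    using assms by (simp add: z bij_inv_apply cyc3_def inj)
qed

lemma cycle123_eq: "cycle123 = cyc3 1 2 3"
  by (auto simp: fun_eq_iff cycle123_apply cyc3_def)

lemma translation_eq: "translation = shift 1"
  by (auto simp: fun_eq_iff translation_def shift_def)

lemma SymZ_mult: "f \<otimes>\<^bsub>SymZ\<^esub> g = g \<circ> f"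
  by (simp add: SymZ_def)

lemma SymZ_one: "\<one>\<^bsub>SymZ\<^esub> = id"
  by (simp add: SymZ_def)

lemma SymZ_carrier: "carrier SymZ = {f. bij f}"
  by (simp add: SymZ_def)

lemma SymZ_inv: "bij f \<Longrightarrow> m_inv SymZ f = perm_inv f"
  using group.inv_equality[OF group_SymZ, of "perm_inv f" f]
  by (simp add: SymZ_def bij_imp_bij_inv fun_eq_iff bij_apply_inv)

section \<open>Permutation groups that contain three-cycles\<close>

locale int_perm_group =
  fixes H :: "(int \<Rightarrow> int) set"
  assumes subgroup_SymZ: "subgroup H SymZ"
begin

lemma bij: "f \<in> H \<Longrightarrow> bij f"
  using subgroup.subset[OF subgroup_SymZ] by (auto simp: SymZ_def)

lemma comp: "f \<in> H \<Longrightarrow> g \<in> H \<Longrightarrow> f \<circ> g \<in> H"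
  using subgroup.m_closed[OF subgroup_SymZ, of g f] by (simp add: SymZ_def)

lemma id: "id \<in> H"
  using subgroup.one_closed[OF subgroup_SymZ] by (simp add: SymZ_def)

lemma inverse: "f \<in> H \<Longrightarrow> perm_inv f \<in> H"
  using subgroup.m_inv_closed[OF subgroup_SymZ, of f] by (simp add: SymZ_inv bij)

lemma conj: "f \<in> H \<Longrightarrow> g \<in> H \<Longrightarrow> f \<circ> g \<circ> perm_inv f \<in> H"
  by (intro comp inverse)

lemma shift_multiple:
  assumes n: "shift n \<in> H" and "n dvd d"
  shows "shift d \<in> H"
proof -
  have nat: "shift (n * int j) \<in> H" for j
  proof (induction j)
    case (Suc j)
    have "shift n \<circ> shift (n * int j) \<in> H" using Suc n by (intro comp)
    then show ?case by (simp add: shift_comp algebra_simps)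
  qed (use id in \<open>simp add: shift_0 id_def\<close>)
  obtain e where d: "d = n * e" using assms(2) by auto
  show ?thesis
  proof (cases "e \<ge> 0")
    case True then show ?thesis using nat[of "nat e"] by (simp add: d)
  next
    case False
    then show ?thesis using inverse[OF nat[of "nat (- e)"]] by (simp add: d perm_inv_shift)
  qed
qed

lemma conj_cyc3_mem:
  assumes "f \<in> H" "cyc3 a b c \<in> H" "distinct [a, b, c]"
  shows "cyc3 (f a) (f b) (f c) \<in> H"
  using conj[OF assms(1,2)] unfolding conj_cyc3[OF bij[OF assms(1)] assms(3)] .

text \<open>
  For a transitive group the classes of this relation are blocks of imprimitivity.
\<close>

definition linked :: "int \<Rightarrow> int \<Rightarrow> bool" where
  "linked a b \<longleftrightarrow> a = b \<or> (\<exists>c. distinct [a, b, c] \<and> cyc3 a b c \<in> H)"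

lemma linked_refl: "linked a a"
  by (simp add: linked_def)

lemma linked_cyc3:
  assumes "cyc3 a b c \<in> H" "distinct [a, b, c]"
  shows "linked a b" "linked b c" "linked c a"
  using assms cyc3_rotate[of a b c] cyc3_rotate[of b c a] by (auto simp: linked_def)

lemma linked_sym:
  assumes "linked a b"
  shows "linked b a"
proof (cases "a = b")
  case False
  then obtain c where c: "distinct [a, b, c]" "cyc3 a b c \<in> H"
    using assms by (auto simp: linked_def)
  then have "cyc3 a c b \<in> H" using inverse[of "cyc3 a b c"] by (simp add: perm_inv_cyc3)
  then show ?thesis using c linked_cyc3(3)[of a c b] by auto
qed (simp add: linked_refl)

lemma linked_image:
  assumes "f \<in> H" "linked a b"
  shows "linked (f a) (f b)"
proof (cases "a = b")
  case False
  then obtain c where c: "distinct [a, b, c]" "cyc3 a b c \<in> H"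
    using assms by (auto simp: linked_def)
  have "distinct [f a, f b, f c]"
    using c(1) bij[OF assms(1)] by (auto simp: bij_def inj_eq)
  then show ?thesis using conj_cyc3_mem[OF assms(1) c(2,1)] linked_cyc3(1) by blast
qed (simp add: linked_refl)

text \<open>
  A three-cycle \<open>(b c y)\<close> in the group carries \<open>b\<close> to \<open>c\<close>. If it fixes \<open>a\<close>, it carries a
  three-cycle through \<open>a\<close> and \<open>b\<close> to one through \<open>a\<close> and \<open>c\<close>; if \<open>a = y\<close>, it is itself one.
\<close>

lemma linked_trans:
  assumes ab: "linked a b" and bc: "linked b c"
  shows "linked a c"
proof (cases "b = c \<or> a = c")
  case True then show ?thesis using ab by (auto simp: linked_refl)
next
  case False
  then obtain y where y: "distinct [b, c, y]" "cyc3 b c y \<in> H"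
    using bc by (auto simp: linked_def)
  consider "a = b" | "a = y" | "a \<noteq> b" "a \<noteq> c" "a \<noteq> y" using False by auto
  then show ?thesis
  proof cases
    case 1 then show ?thesis using bc by simp
  next
    case 2 then show ?thesis using linked_sym[OF linked_cyc3(2)[OF y(2,1)]] by simp
  next
    case 3
    then show ?thesis using linked_image[OF y(2) ab] by (simp add: cyc3_def)
  qed
qed

text \<open>
  Choose a three-cycle \<open>(a b x)\<close> and move \<open>x\<close> to \<open>c\<close> by conjugation with some \<open>(x c z)\<close>. This is
  immediate unless \<open>z\<close> is \<open>a\<close> or \<open>b\<close>, and then everything happens inside the alternating group
  on \<open>a, b, x, c\<close>.
\<close>

lemma all_cyc3_mem:
  assumes all: "\<And>a b. linked a b" and d: "distinct [a, b, c]"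
  shows "cyc3 a b c \<in> H"
proof -
  obtain x where x: "distinct [a, b, x]" "cyc3 a b x \<in> H"
    using all[of a b] d by (auto simp: linked_def)
  show ?thesis
  proof (cases "x = c")
    case False
    then obtain z where z: "distinct [x, c, z]" "cyc3 x c z \<in> H"
      using all[of x c] by (auto simp: linked_def)
    consider "z = a" | "z = b" | "z \<noteq> a" "z \<noteq> b" by auto
    then show ?thesis
    proof cases
      case 1
      \<comment> \<open>Conjugating \<open>(a b x)\<close> by \<open>(x c a)\<close> once gives \<open>(x b c)\<close>, twice \<open>(c b a)\<close>.\<close>
      have "cyc3 x b c \<in> H"
        using conj_cyc3_mem[OF z(2) x(2,1)] 1 x z d by (simp add: cyc3_def[of x c])
      then have "cyc3 c b a \<in> H"
        using conj_cyc3_mem[OF z(2), of x b c] 1 x z d by (simp add: cyc3_def[of x c])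
      then have "cyc3 c a b \<in> H"
        using inverse[of "cyc3 c b a"] d by (simp add: perm_inv_cyc3)
      then show ?thesis using cyc3_rotate[of c a b] d by auto
    next
      case 2
      have "cyc3 a x c \<in> H"
        using conj_cyc3_mem[OF z(2) x(2,1)] 2 x z d by (simp add: cyc3_def[of x c])
      then have "cyc3 a c b \<in> H"
        using conj_cyc3_mem[OF z(2), of a x c] 2 x z d by (simp add: cyc3_def[of x c])
      then show ?thesis
        using inverse[of "cyc3 a c b"] d by (simp add: perm_inv_cyc3)
    next
      case 3
      then show ?thesis
        using conj_cyc3_mem[OF z(2) x(2,1)] x z d by (simp add: cyc3_def[of x c])
    qed
  qed (use x in simp)
qed

text \<open>
  Away from \<open>p\<close>, \<open>f p\<close> and \<open>g p\<close>, the common point \<open>p\<close> does not interfere: every point there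
  takes part in at most one of the two permutations, so the commutator fixes it.
\<close>

lemma commutator_cyc3:
  assumes f: "f \<in> H" and g: "g \<in> H"
    and p: "f p \<noteq> p" "g p \<noteq> p"
    and single: "\<And>z. f z \<noteq> z \<Longrightarrow> g z \<noteq> z \<Longrightarrow> z = p"
  shows "cyc3 (g p) p (f p) \<in> H" "distinct [g p, p, f p]"
proof -
  have fe: "f x = f y \<longleftrightarrow> x = y" and ge: "g x = g y \<longleftrightarrow> x = y" for x y
    using bij[OF f] bij[OF g] by (auto simp: bij_def inj_eq)
  let ?F = "perm_inv f" and ?G = "perm_inv g"
  have F: "?F (f x) = x" "f (?F x) = x" for x using bij[OF f] by (auto simp: bij_inv_apply bij_apply_inv)
  have G: "?G (g x) = x" "g (?G x) = x" for x using bij[OF g] by (auto simp: bij_inv_apply bij_apply_inv)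
  have fp: "g (f p) = f p" using single[of "f p"] p fe by metis
  have gp: "f (g p) = g p" using single[of "g p"] p ge by metis
  show d: "distinct [g p, p, f p]" using p fp ge by auto metis
  have "(f \<circ> g \<circ> perm_inv f \<circ> perm_inv g) z = cyc3 (g p) p (f p) z" for z
  proof -
    consider "z = g p" | "z = p" | "z = f p" | "z \<noteq> g p" "z \<noteq> p" "z \<noteq> f p" by auto
    then show ?thesis
    proof cases
      case 1
      have "?F p \<noteq> p" using F(2)[of p] p by metis
      moreover have "f (?F p) \<noteq> ?F p" using F(2)[of p] calculation by metis
      ultimately have "g (?F p) = ?F p" using single by blast
      then show ?thesis using 1 d by (simp add: F G cyc3_def)
    next
      case 2
      have "?G p \<noteq> p" using G(2)[of p] p by metis
      moreover have "g (?G p) \<noteq> ?G p" using G(2)[of p] calculation by metis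
      ultimately have "f (?G p) = ?G p" using single by blast
      then have "?F (?G p) = ?G p" using F(1) by metis
      then show ?thesis using 2 d by (simp add: F G cyc3_def)
    next
      case 3
      have "?G (f p) = f p" using fp G(1) by metis
      then show ?thesis using 3 d gp by (simp add: F G cyc3_def)
    next
      case 4
      show ?thesis
      proof (cases "g z = z")
        case True
        then have Gz: "?G z = z" using G(1) by metis
        have "g (?F z) = ?F z"
        proof (cases "f z = z")
          case fz: True then show ?thesis using True F(1) by metis
        next
          case False
          then have "f (?F z) \<noteq> ?F z" using F(2) by metis
          moreover have "?F z \<noteq> p" using 4 F(2) by metis
          ultimately show ?thesis using single by blast
        qed
        then show ?thesis using 4 by (simp add: Gz F cyc3_def)
      next
        case False
        then have "g (?G z) \<noteq> ?G z" using G(2) by metis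
        moreover have "?G z \<noteq> p" using 4 G(2) by metis
        ultimately have "f (?G z) = ?G z" using single by blast
        then have "?F (?G z) = ?G z" using F(1) by metis
        moreover have "f z = z" using False 4 single by blast
        ultimately show ?thesis using 4 by (simp add: G cyc3_def)
      qed
    qed
  qed
  then have "f \<circ> g \<circ> perm_inv f \<circ> perm_inv g = cyc3 (g p) p (f p)" by blast
  moreover have "f \<circ> g \<circ> perm_inv f \<circ> perm_inv g \<in> H" using f g by (intro comp inverse)
  ultimately show "cyc3 (g p) p (f p) \<in> H" by simp
qed

text \<open>
  Call \<open>z\<close> unbounded if it is linked to some \<open>z + e\<close> with \<open>e \<noteq> 0\<close> even; its class then contains
  \<open>z + j e\<close> for all natural numbers \<open>j\<close>, so an element of finite support fixes some point of the
  class and hence maps the class to itself. Some point is unbounded because two of \<open>a, b, c\<close> have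
  the same parity, and invariance under \<open>shift 2\<close> extends this to all points of that parity.
  The arrow from \<open>v\<close> to \<open>f v\<close> joins the two parities, and the arrow at \<open>u\<close> links neighbouring
  even numbers.
\<close>

lemma linked_all_if_steps:
  assumes s2: "shift 2 \<in> H"
    and f: "f \<in> H" and fin: "finite {z. f z \<noteq> z}"
    and cyc: "distinct [a, b, c]" "cyc3 a b c \<in> H"
    and step: "even u" "\<bar>f u - u\<bar> = 2"
    and cross: "even v" "odd (f v)"
  shows "linked x y"
proof -
  have tr: "linked (z + e) (w + e)" if "linked z w" "even e" for z w e
    using linked_image[OF shift_multiple[OF s2] that(1), of e] that(2) by (simp add: shift_def)
  define unb where "unb z \<longleftrightarrow> (\<exists>e. e \<noteq> 0 \<and> even e \<and> linked z (z + e))" for z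
  have unb_tr: "unb (z + e)" if "unb z" "even e" for z e
    using that tr unfolding unb_def by (metis add.assoc add.commute)
  have unb_linked: "unb w" if "unb z" "linked z w" for z w
    using that tr linked_trans linked_sym unfolding unb_def by meson
  have h_linked: "linked (h z) z"
    if h: "h \<in> H" "finite {z. h z \<noteq> z}" and z: "unb z" for h z
  proof -
    obtain e where e: "e \<noteq> 0" "even e" "linked z (z + e)" using z unfolding unb_def by auto
    have mult: "linked z (z + int j * e)" for j
    proof (induction j)
      case (Suc j)
      have "linked (z + int j * e) (z + int (Suc j) * e)"
        using tr[OF e(3), of "int j * e"] e(2) by (simp add: algebra_simps)
      then show ?case using Suc linked_trans by blast
    qed (simp add: linked_refl)
    have "inj (\<lambda>j. z + int j * e)" using e(1) by (auto intro: injI)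
    then have "infinite (range (\<lambda>j. z + int j * e))" by (rule range_inj_infinite)
    then have "\<not> range (\<lambda>j. z + int j * e) \<subseteq> {z. h z \<noteq> z}" using h(2) finite_subset by blast
    then obtain j where j: "h (z + int j * e) = z + int j * e" by auto
    have "linked (h z) (z + int j * e)" using linked_image[OF h(1) mult[of j]] j by simp
    then show ?thesis using mult linked_sym linked_trans by blast
  qed
  \<comment> \<open>The inverse is needed when the unbounded points are the odd ones: then \<open>f v\<close> is unbounded,
    and it is the inverse that maps \<open>f v\<close> within its class, to \<open>v\<close>.\<close>
  let ?g = "perm_inv f"
  have "{z. ?g z \<noteq> z} \<subseteq> {z. f z \<noteq> z}"
    using bij_inv_apply[OF bij[OF f]] by auto metis
  then have g: "?g \<in> H" "finite {z. ?g z \<noteq> z}" "?g (f v) = v"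
    using fin finite_subset inverse[OF f] bij_inv_apply[OF bij[OF f]] by auto
  have "\<exists>z. unb z"
  proof -
    have "linked a (a + (b - a))" "linked b (b + (c - b))" "linked c (c + (a - c))"
      using linked_cyc3[OF cyc(2,1)] by simp_all
    moreover have "even (b - a) \<or> even (c - b) \<or> even (a - c)" by presburger
    ultimately show ?thesis using cyc(1) unfolding unb_def
      by (metis distinct_length_2_or_more eq_iff_diff_eq_0)
  qed
  then obtain z0 where z0: "unb z0" ..
  have "unb v \<or> unb (f v)"
  proof (cases "even z0")
    case True
    then show ?thesis using unb_tr[OF z0, of "v - z0"] cross by simp
  next
    case False
    then show ?thesis using unb_tr[OF z0, of "f v - z0"] cross by simp
  qed
  then have fv: "linked (f v) v"
    using h_linked[OF f fin] h_linked[OF g(1,2)] g(3) linked_sym by metis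
  then have unb_v: "unb v" "unb (f v)"
    using \<open>unb v \<or> unb (f v)\<close> unb_linked linked_sym by blast+
  have "unb u" using unb_tr[OF unb_v(1), of "u - v"] step(1) cross(1) by simp
  then have "linked (f u) u" by (rule h_linked[OF f fin])
  moreover have "f u = u + 2 \<or> f u + 2 = u" using step(2) by arith
  ultimately have "linked u (u + 2)" using tr[of "f u" u 2] linked_sym by auto
  then have two: "linked e (e + 2)" if "even e" for e
    using tr[of u "u + 2" "e - u"] that step(1) by (simp add: algebra_simps)
  have even_linked: "linked 0 e" if "even e" for e
  proof -
    have pos: "linked d (d + 2 * int j)" if "even d" for d j
    proof (induction j)
      case (Suc j)
      have "linked (d + 2 * int j) (d + 2 * int (Suc j))"
        using two[of "d + 2 * int j"] that by (simp add: algebra_simps)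
      then show ?case using Suc linked_trans by blast
    qed (simp add: linked_refl)
    obtain k where k: "e = 2 * k" using \<open>even e\<close> by auto
    show ?thesis
    proof (cases "k \<ge> 0")
      case True then show ?thesis using pos[of 0 "nat k"] k by simp
    next
      case False then show ?thesis using pos[of e "nat (- k)"] k linked_sym by simp
    qed
  qed
  have zero: "linked 0 z" for z
  proof (cases "even z")
    case False
    have "linked z (v + (z - f v))" using tr[OF fv, of "z - f v"] False cross(2) by simp
    moreover have "linked 0 (v + (z - f v))" using even_linked False cross by simp
    ultimately show ?thesis using linked_sym linked_trans by blast
  qed (rule even_linked)
  show ?thesis using zero linked_sym linked_trans by blast
qed

lemma all_cyc3_mem_if_cyc3_shift:
  assumes "cyc3 1 2 3 \<in> H" "shift 2 \<in> H" "distinct [a, b, c]"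
  shows "cyc3 a b c \<in> H"
proof (rule all_cyc3_mem[OF _ assms(3)])
  have tr: "linked (z + e) (w + e)" if "linked z w" "even e" for z w e
    using linked_image[OF shift_multiple[OF assms(2)] that(1), of e] that(2) by (simp add: shift_def)
  have base: "linked 1 2" "linked 2 3" "linked 1 3"
    using linked_cyc3[OF assms(1)] linked_sym by auto
  have one: "linked z (z + 1)" for z
    using tr[OF base(1), of "z - 1"] tr[OF base(2), of "z - 2"] by (cases "even z") (auto simp: add.commute)
  have pos: "linked z (z + int j)" for z j
  proof (induction j)
    case (Suc j)
    have "linked (z + int j) (z + int (Suc j))" using one[of "z + int j"] by (simp add: algebra_simps)
    then show ?case using Suc linked_trans by blast
  qed (simp add: linked_refl)
  show "linked x y" for x y
    using pos[of x "nat (y - x)"] pos[of y "nat (x - y)"] linked_sym by (cases "x \<le> y") auto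
qed

text \<open>
  High transitivity: points are brought into place one at a time, by three-cycles whose third point
  \<open>q\<close> avoids the values already attained.
\<close>

lemma exists_mem_extending:
  assumes cyc: "\<And>a b c. distinct [a, b, c] \<Longrightarrow> cyc3 a b c \<in> H"
    and "finite S" "inj_on f S"
  shows "\<exists>y\<in>H. finite {z. y z \<noteq> z} \<and> (\<forall>x\<in>S. y x = f x)"
  using assms(2,3)
proof (induction S rule: finite_induct)
  case empty
  then show ?case by (intro bexI[OF _ id]) auto
next
  case (insert x S)
  then obtain y where y: "y \<in> H" "finite {z. y z \<noteq> z}" "\<forall>x\<in>S. y x = f x" by auto
  show ?case
  proof (cases "y x = f x")
    case True
    then show ?thesis using y by auto
  next
    case False
    have "\<exists>q. q \<notin> f ` S \<union> {y x, f x}"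
      using ex_new_if_finite[OF infinite_UNIV_int, of "f ` S \<union> {y x, f x}"] insert.hyps(1) by simp
    then obtain q where q: "q \<notin> f ` S" "q \<noteq> y x" "q \<noteq> f x" by auto
    have yx: "y x \<notin> f ` S"
      using y(3) insert.hyps(2) bij[OF y(1)] by (metis bij_def image_iff inj_eq)
    have fx: "f x \<notin> f ` S" using insert by (auto simp: inj_on_def)
    let ?c = "cyc3 (y x) (f x) q"
    have "?c \<circ> y \<in> H" using False q by (intro comp cyc y) auto
    moreover have "{z. (?c \<circ> y) z \<noteq> z} \<subseteq> {z. y z \<noteq> z} \<union> {y x, f x, q}"
    proof
      fix z assume "z \<in> {z. (?c \<circ> y) z \<noteq> z}"
      then show "z \<in> {z. y z \<noteq> z} \<union> {y x, f x, q}"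
        using cyc3_fixes[of z "y x" "f x" q] by (cases "y z = z") auto
    qed
    then have "finite {z. (?c \<circ> y) z \<noteq> z}" by (rule finite_subset) (use y(2) in simp)
    moreover have "(?c \<circ> y) s = f s" if "s \<in> insert x S" for s
    proof (cases "s = x")
      case False
      then have "s \<in> S" using that by simp
      then have "f s \<noteq> y x" "f s \<noteq> f x" "f s \<noteq> q" using yx fx q(1) by (metis imageI)+
      then show ?thesis using y(3) \<open>s \<in> S\<close> by (simp add: cyc3_fixes)
    qed (simp add: cyc3_def)
    ultimately show ?thesis by blast
  qed
qed

text \<open>
  Control over the extreme moved points \<open>A\<close> and \<open>B\<close> of \<open>y\<close> is what later determines the extreme
  points of the support of a relabelled translation. A three-cycle on far even points that is
  applied after the extension provides it.
\<close>

lemma exists_mem_extending_far: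
  assumes cyc: "\<And>a b c. distinct [a, b, c] \<Longrightarrow> cyc3 a b c \<in> H"
    and S: "finite S" "inj_on f S"
  obtains y A B where "y \<in> H" "\<And>x. x \<in> S \<Longrightarrow> y x = f x"
    "even A" "even B" "A < - L" "L < B" "y A \<noteq> A" "y B \<noteq> B"
    "\<And>z. z < A \<or> B < z \<Longrightarrow> y z = z"
proof -
  obtain y where y: "y \<in> H" "finite {z. y z \<noteq> z}" "\<forall>x\<in>S. y x = f x"
    using exists_mem_extending[OF cyc S] by auto
  define M where "M = Max (abs ` (S \<union> f ` S \<union> {z. y z \<noteq> z} \<union> {L}))"
  have M: "\<bar>x\<bar> \<le> M" if "x \<in> S \<union> f ` S \<union> {z. y z \<noteq> z} \<union> {L}" for x
    unfolding M_def using S(1) y(2) that by (intro Max_ge) auto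
  define X where "X = 2 * (M + 1)"
  have L: "\<bar>L\<bar> \<le> M" by (rule M) auto
  have X: "X > M" "even X" "X > 0" "L < X" using L by (auto simp: X_def)
  have far: "y z = z" if "\<bar>z\<bar> > M" for z using M[of z] that by force
  let ?c = "cyc3 (- X) X (X + 2)"
  show thesis
  proof (rule that[of "?c \<circ> y" "- X" "X + 2"])
    show "?c \<circ> y \<in> H" using X by (intro comp cyc y) auto
    show "(?c \<circ> y) x = f x" if "x \<in> S" for x
      using M[of "f x"] that y(3) X by (auto simp: cyc3_def)
    show "(?c \<circ> y) (- X) \<noteq> - X" "(?c \<circ> y) (X + 2) \<noteq> X + 2" using X far by (auto simp: cyc3_def)
    show "(?c \<circ> y) z = z" if "z < - X \<or> X + 2 < z" for z
      using that X far[of z] by (auto simp: cyc3_def)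
  qed (use X in auto)
qed

end

lemma int_perm_groupI:
  assumes "\<And>f. f \<in> H \<Longrightarrow> bij f" "id \<in> H"
    and "\<And>f g. f \<in> H \<Longrightarrow> g \<in> H \<Longrightarrow> f \<circ> g \<in> H" "\<And>f. f \<in> H \<Longrightarrow> perm_inv f \<in> H"
  shows "int_perm_group H"
proof (intro int_perm_group.intro group.subgroupI[OF group_SymZ])
  show "H \<subseteq> carrier SymZ" using assms(1) by (auto simp: SymZ_carrier)
  show "H \<noteq> {}" using assms(2) by blast
  show "inv\<^bsub>SymZ\<^esub> f \<in> H" if "f \<in> H" for f using that assms(1,4) by (simp add: SymZ_inv)
  show "f \<otimes>\<^bsub>SymZ\<^esub> g \<in> H" if "f \<in> H" "g \<in> H" for f g using that assms(3) by (simp add: SymZ_mult)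
qed

lemma int_perm_group_generate:
  assumes "A \<subseteq> carrier SymZ"
  shows "int_perm_group (generate SymZ A)"
  using assms by (intro int_perm_group.intro group.generate_is_subgroup[OF group_SymZ])

lemma int_perm_group_conj:
  assumes "int_perm_group K" "bij y"
  shows "int_perm_group {f. bij f \<and> perm_inv y \<circ> f \<circ> y \<in> K}"
proof -
  interpret K: int_perm_group K by fact
  have y: "y (perm_inv y z) = z" "perm_inv y (y z) = z" for z
    using bij_inv_apply[OF assms(2)] bij_apply_inv[OF assms(2)] by auto
  show ?thesis
  proof (rule int_perm_groupI)
    have "perm_inv y \<circ> id \<circ> y = id" by (simp add: fun_eq_iff y)
    then show "id \<in> {f. bij f \<and> perm_inv y \<circ> f \<circ> y \<in> K}" using K.id by simp
  next
    fix f g assume fg: "f \<in> {f. bij f \<and> perm_inv y \<circ> f \<circ> y \<in> K}" "g \<in> {f. bij f \<and> perm_inv y \<circ> f \<circ> y \<in> K}"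
    have "perm_inv y \<circ> (f \<circ> g) \<circ> y = (perm_inv y \<circ> f \<circ> y) \<circ> (perm_inv y \<circ> g \<circ> y)"
      by (simp add: fun_eq_iff y)
    then show "f \<circ> g \<in> {f. bij f \<and> perm_inv y \<circ> f \<circ> y \<in> K}"
      using fg K.comp[of "perm_inv y \<circ> f \<circ> y" "perm_inv y \<circ> g \<circ> y"] bij_comp[of g f] by simp
  next
    fix f assume f: "f \<in> {f. bij f \<and> perm_inv y \<circ> f \<circ> y \<in> K}"
    have "perm_inv (perm_inv y \<circ> f \<circ> y) = perm_inv y \<circ> perm_inv f \<circ> y"
      using f by (intro perm_inv_eqI) (simp_all add: fun_eq_iff y bij_inv_apply bij_apply_inv)
    then show "perm_inv f \<in> {f. bij f \<and> perm_inv y \<circ> f \<circ> y \<in> K}"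
      using f K.inverse[of "perm_inv y \<circ> f \<circ> y"] bij_imp_bij_inv[of f] by simp
  qed simp
qed

section \<open>Even permutations up to translation\<close>

text \<open>
  Rearranging a product of translations and permutations of finite support conjugates the latter
  by translations. Parity survives this because the conjugates of a transposition under arbitrary
  bijections, of infinite support too, are transpositions.
\<close>

lemma swapidseq_conj:
  assumes "swapidseq m p" "bij s"
  shows "swapidseq m (s \<circ> p \<circ> inv_into UNIV s)"
  using assms(1)
proof induction
  case id
  have "s \<circ> inv_into UNIV s = id" using assms(2) by (simp add: bij_is_surj surj_iff[symmetric])
  then show ?case by (simp add: id_def)
next
  case (comp_Suc m p a b)
  have eq: "s \<circ> (Transposition.transpose a b \<circ> p) \<circ> inv_into UNIV s =
      Transposition.transpose (s a) (s b) \<circ> (s \<circ> p \<circ> inv_into UNIV s)"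
    using assms(2) by (auto simp: fun_eq_iff Transposition.transpose_def bij_def inj_eq)
  have "s a \<noteq> s b" using comp_Suc assms(2) by (simp add: bij_def inj_eq)
  then show ?case unfolding eq using comp_Suc by (intro swapidseq.comp_Suc)
qed

lemma evenperm_conj:
  assumes "permutation p" "bij s"
  shows "permutation (s \<circ> p \<circ> inv_into UNIV s)"
    and "evenperm (s \<circ> p \<circ> inv_into UNIV s) = evenperm p"
proof -
  obtain m where m: "swapidseq m p" using assms(1) by (auto simp: permutation_def)
  from swapidseq_conj[OF this assms(2)] show "permutation (s \<circ> p \<circ> inv_into UNIV s)"
    by (auto simp: permutation_def)
  show "evenperm (s \<circ> p \<circ> inv_into UNIV s) = evenperm p"
    using evenperm_unique[OF swapidseq_conj[OF m assms(2)]] evenperm_unique[OF m] by blast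
qed

lemma evenperm_cyc3:
  assumes "distinct [a, b, c]"
  shows "permutation (cyc3 a b c)" "evenperm (cyc3 a b c)"
proof -
  have eq: "cyc3 a b c = Transposition.transpose a b \<circ> Transposition.transpose b c"
    using assms by (auto simp: fun_eq_iff cyc3_def Transposition.transpose_def)
  show "permutation (cyc3 a b c)" "evenperm (cyc3 a b c)"
    unfolding eq using assms
    by (auto simp: evenperm_comp permutation_swap_id evenperm_swap intro: permutation_compose)
qed

text \<open>
  These are the elements of the group generated by all translations and all three-cycles, with
  the translation length \<open>k\<close> made explicit.
\<close>

definition even_translation :: "int \<Rightarrow> (int \<Rightarrow> int) \<Rightarrow> bool" where
  "even_translation k f \<longleftrightarrow> permutation (shift (- k) \<circ> f) \<and> evenperm (shift (- k) \<circ> f)"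

lemma even_translation_bij:
  assumes "even_translation k f"
  shows "bij f"
proof -
  have "f = shift k \<circ> (shift (- k) \<circ> f)" by (simp add: fun_eq_iff shift_def)
  then show ?thesis
    using assms bij_comp[OF permutation_bijective bij_shift] by (metis even_translation_def)
qed

lemma even_translation_shift: "even_translation k (shift k)"
  by (simp add: even_translation_def shift_comp shift_0)

lemma even_translation_cyc3:
  "distinct [a, b, c] \<Longrightarrow> even_translation 0 (cyc3 a b c)"
  using evenperm_cyc3 by (simp add: even_translation_def shift_0)

lemma even_translation_comp:
  assumes "even_translation k f" "even_translation l g"
  shows "even_translation (k + l) (f \<circ> g)"
proof -
  let ?f = "shift (- k) \<circ> f" and ?g = "shift (- l) \<circ> g"
  have eq: "shift (- (k + l)) \<circ> (f \<circ> g) = (shift (- l) \<circ> ?f \<circ> perm_inv (shift (- l))) \<circ> ?g"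
    by (simp add: fun_eq_iff shift_def perm_inv_shift)
  show ?thesis
    unfolding even_translation_def eq
    using assms evenperm_conj[of ?f, OF _ bij_shift[of "- l"]]
    by (simp add: even_translation_def evenperm_comp permutation_compose del: o_apply)
qed

lemma even_translation_inverse:
  assumes "even_translation k f"
  shows "even_translation (- k) (perm_inv f)"
proof -
  let ?f = "shift (- k) \<circ> f"
  have f: "permutation ?f" "evenperm ?f" using assms by (auto simp: even_translation_def)
  have inv: "perm_inv ?f = perm_inv f \<circ> shift k"
    using even_translation_bij[OF assms] by (subst o_inv_distrib) (auto simp: bij_shift perm_inv_shift)
  have eq: "shift (- (- k)) \<circ> perm_inv f = shift k \<circ> perm_inv ?f \<circ> perm_inv (shift k)"
    unfolding inv by (simp add: fun_eq_iff shift_def perm_inv_shift)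
  show ?thesis
    unfolding even_translation_def eq
    using evenperm_conj[OF permutation_inverse[OF f(1)] bij_shift[of k]] f
    by (simp add: evenperm_inv)
qed

lemma even_translation_far:
  assumes "even_translation k f"
  obtains L where "L \<ge> 0" "\<And>z. \<bar>z\<bar> > L \<Longrightarrow> f z = z + k"
proof -
  have "finite {z. (shift (- k) \<circ> f) z \<noteq> z}"
    using assms permutation_finite_support unfolding even_translation_def by blast
  then have fin: "finite (insert 0 (abs ` {z. f z \<noteq> z + k}))"
    by (intro finite.insertI finite_imageI) (simp add: shift_def algebra_simps)
  show thesis
  proof
    show "Max (insert 0 (abs ` {z. f z \<noteq> z + k})) \<ge> 0" using fin by (intro Max_ge) auto
    show "f z = z + k" if "\<bar>z\<bar> > Max (insert 0 (abs ` {z. f z \<noteq> z + k}))" for z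
    proof (rule ccontr)
      assume "f z \<noteq> z + k"
      then have "\<bar>z\<bar> \<le> Max (insert 0 (abs ` {z. f z \<noteq> z + k}))" using fin by (intro Max_ge) auto
      then show False using that by simp
    qed
  qed
qed

text \<open>
  Otherwise every moved point would be \<open>q\<close> or the preimage of \<open>q\<close>, so \<open>f\<close> would be a
  transposition, which is odd.
\<close>

lemma even_translation_0_edge:
  assumes "even_translation 0 f" "f \<noteq> id"
  obtains w where "f w \<noteq> w" "w \<noteq> q" "f w \<noteq> q"
proof (rule ccontr)
  assume "\<not> thesis"
  then have *: "f w = w \<or> w = q \<or> f w = q" for w using that by blast
  have p: "permutation f" "evenperm f" using assms by (auto simp: even_translation_def shift_0)
  have b: "bij f" using p permutation_bijective by blast
  let ?r = "perm_inv f q"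
  have r: "f ?r = q" using b by (rule bij_apply_inv)
  have inj: "f x = f y \<longleftrightarrow> x = y" for x y using b by (auto simp: bij_def inj_eq)
  have "f = Transposition.transpose ?r q"
  proof
    fix z
    have "f q = ?r" using *[of "f q"] r inj by metis
    moreover have "f z = z" if "z \<noteq> q" "z \<noteq> ?r" using *[of z] that r inj by metis
    ultimately show "f z = Transposition.transpose ?r q z"
      using r by (auto simp: Transposition.transpose_def)
  qed
  then have "evenperm f = (?r = q)" using evenperm_swap by metis
  then have "?r = q" using p by simp
  then have "f = id" using \<open>f = Transposition.transpose ?r q\<close> by simp
  then show False using assms by simp
qed

section \<open>The groups generated by a three-cycle and a translation\<close>

definition Gn :: "int \<Rightarrow> (int \<Rightarrow> int) monoid" where
  "Gn n = subgroup_generated SymZ {cyc3 1 2 3, shift n}"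

lemma carrier_Gn: "carrier (Gn n) = generate SymZ {cyc3 1 2 3, shift n}"
proof -
  have "{cyc3 1 2 3, shift n} \<subseteq> carrier SymZ" by (auto simp: SymZ_carrier bij_shift intro: bij_cyc3)
  then show ?thesis by (simp add: Gn_def carrier_subgroup_generated Int_absorb1)
qed

lemma int_perm_group_Gn: "int_perm_group (carrier (Gn n))"
proof -
  have "{cyc3 1 2 3, shift n} \<subseteq> carrier SymZ" by (auto simp: SymZ_carrier bij_shift intro: bij_cyc3)
  then show ?thesis
    unfolding carrier_Gn by (intro int_perm_group.intro group.generate_is_subgroup[OF group_SymZ])
qed

lemma shift_mem_Gn: "shift n \<in> carrier (Gn n)" and cyc3_123_mem_Gn: "cyc3 1 2 3 \<in> carrier (Gn n)"
  by (auto simp: carrier_Gn intro: generate.incl)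

lemma cyc3_mem_Gn:
  assumes "n dvd 2" "distinct [a, b, c]"
  shows "cyc3 a b c \<in> carrier (Gn n)"
proof -
  interpret int_perm_group "carrier (Gn n)" by (rule int_perm_group_Gn)
  show ?thesis
    using all_cyc3_mem_if_cyc3_shift[OF cyc3_123_mem_Gn _ assms(2)] shift_multiple[OF shift_mem_Gn assms(1)]
    by blast
qed

lemma Gn_subset:
  assumes "int_perm_group H" "cyc3 1 2 3 \<in> H" "shift n \<in> H"
  shows "carrier (Gn n) \<subseteq> H"
  unfolding carrier_Gn
  using assms by (intro group.generate_subgroup_incl[OF group_SymZ]) (auto simp: int_perm_group_def)

lemma even_translation_Gn:
  assumes "f \<in> carrier (Gn n)"
  obtains k where "n dvd k" "even_translation k f"
proof -
  let ?E = "{f. \<exists>k. n dvd k \<and> even_translation k f}"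
  have "subgroup ?E SymZ"
  proof (rule group.subgroupI[OF group_SymZ])
    show "?E \<subseteq> carrier SymZ" using even_translation_bij by (auto simp: SymZ_carrier)
    show "?E \<noteq> {}" using even_translation_shift[of 0] by auto
  next
    fix f assume "f \<in> ?E"
    then obtain k where k: "n dvd k" "even_translation k f" by auto
    show "inv\<^bsub>SymZ\<^esub> f \<in> ?E"
      using even_translation_inverse[OF k(2)] k(1)
      by (auto simp: SymZ_inv even_translation_bij[OF k(2)] intro!: exI[of _ "- k"])
  next
    fix f g assume "f \<in> ?E" "g \<in> ?E"
    then obtain k l where "n dvd k" "even_translation k f" "n dvd l" "even_translation l g" by auto
    then show "f \<otimes>\<^bsub>SymZ\<^esub> g \<in> ?E"
      using even_translation_comp[of l g k f] by (auto simp: SymZ_mult intro!: exI[of _ "l + k"])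
  qed
  moreover have "{cyc3 1 2 3, shift n} \<subseteq> ?E"
  proof -
    have "even_translation 0 (cyc3 1 2 3)" by (rule even_translation_cyc3) simp
    then show ?thesis using even_translation_shift[of n] dvd_refl[of n] dvd_0_right[of n] by blast
  qed
  ultimately have "carrier (Gn n) \<subseteq> ?E"
    unfolding carrier_Gn by (intro group.generate_subgroup_incl[OF group_SymZ])
  then show thesis using assms that by auto
qed

lemma generate_Gn:
  assumes "A \<subseteq> carrier (Gn n)"
  shows "generate (Gn n) A = generate SymZ A"
proof -
  have G: "Gn n = SymZ\<lparr>carrier := carrier (Gn n)\<rparr>"
    by (simp add: Gn_def subgroup_generated_def)
  have "subgroup (carrier (Gn n)) SymZ"
    using int_perm_group_Gn by (simp add: int_perm_group_def)
  then show ?thesis using group.generate_consistent[OF group_SymZ assms] G by simp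
qed

section \<open>Relabellings that create short and odd steps\<close>

text \<open>
  The finite data needed to make \<open>g\<close>, which is a translation by \<open>k\<close> far out, generate together
  with a translation. A relabelling \<open>y\<close> that agrees with \<open>f\<close> on \<open>S\<close> turns \<open>g\<close>, followed by the
  translation by \<open>- k\<close>, into the permutation of finite support that sends \<open>y w\<close> to
  \<open>y (g w) - k\<close>. The first two conditions give it a step of length \<open>2\<close> at an even point and a
  step from an even to an odd point. If \<open>k = 0\<close>, its support is the image of the support of \<open>g\<close>,
  and by the third condition at most one point of it is odd.
\<close>

definition prepared :: "(int \<Rightarrow> int) \<Rightarrow> int \<Rightarrow> int set \<Rightarrow> (int \<Rightarrow> int) \<Rightarrow> bool" where
  "prepared g k S f \<longleftrightarrow>
     (\<exists>w\<in>S. g w \<in> S \<and> even (f w) \<and> \<bar>f (g w) - f w - k\<bar> = 2) \<and>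
     (\<exists>w\<in>S. g w \<in> S \<and> even (f w) \<and> odd (f (g w) - k)) \<and>
     (k = 0 \<longrightarrow> {x. g x \<noteq> x} \<subseteq> S \<and> (\<exists>q. \<forall>x. g x \<noteq> x \<longrightarrow> odd (f x) \<longrightarrow> x = q))"

lemma prepared_mono:
  assumes p: "prepared g k S f" and S: "S \<subseteq> S'" and f': "\<And>x. x \<in> S \<Longrightarrow> f' x = f x"
  shows "prepared g k S' f'"
proof -
  obtain u where u: "u \<in> S" "g u \<in> S" "even (f u)" "\<bar>f (g u) - f u - k\<bar> = 2"
    using p unfolding prepared_def by auto
  obtain v where v: "v \<in> S" "g v \<in> S" "even (f v)" "odd (f (g v) - k)"
    using p unfolding prepared_def by auto
  have "{x. g x \<noteq> x} \<subseteq> S' \<and> (\<exists>q. \<forall>x. g x \<noteq> x \<longrightarrow> odd (f' x) \<longrightarrow> x = q)" if "k = 0"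
  proof -
    obtain q where q: "{x. g x \<noteq> x} \<subseteq> S" "\<forall>x. g x \<noteq> x \<longrightarrow> odd (f x) \<longrightarrow> x = q"
      using p \<open>k = 0\<close> unfolding prepared_def by auto
    have "x = q" if "g x \<noteq> x" "odd (f' x)" for x
    proof -
      have "x \<in> S" using q(1) that(1) by blast
      then show ?thesis using q(2) that f'[of x] by simp
    qed
    then show ?thesis using q(1) S by blast
  qed
  moreover have "\<exists>w\<in>S'. g w \<in> S' \<and> even (f' w) \<and> \<bar>f' (g w) - f' w - k\<bar> = 2"
    using u S f' by (intro bexI[of _ u]) auto
  moreover have "\<exists>w\<in>S'. g w \<in> S' \<and> even (f' w) \<and> odd (f' (g w) - k)"
    using v(1,2) v(3,4) S f'[OF v(1)] f'[OF v(2)] by (intro bexI[of _ v] conjI) (simp_all add: subsetD[OF S])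
  ultimately show ?thesis unfolding prepared_def by blast
qed

lemma inj_on_extend_even:
  fixes f :: "int \<Rightarrow> int"
  assumes "finite A" "finite B" "inj_on f A"
  shows "\<exists>f'. inj_on f' (A \<union> B) \<and> (\<forall>x\<in>A. f' x = f x) \<and> (\<forall>x\<in>B - A. even (f' x))"
  using assms(2)
proof (induction B rule: finite_induct)
  case empty
  then show ?case using assms by auto
next
  case (insert b B)
  then obtain f' where f': "inj_on f' (A \<union> B)" "\<forall>x\<in>A. f' x = f x" "\<forall>x\<in>B - A. even (f' x)" by auto
  show ?case
  proof (cases "b \<in> A")
    case True
    then have "A \<union> insert b B = A \<union> B" by blast
    then show ?thesis using f' True by auto
  next
    case False
    have "infinite (range (\<lambda>i. 2 * int i))"
      by (rule range_inj_infinite) (auto intro: injI)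
    then have "\<not> range (\<lambda>i. 2 * int i) \<subseteq> f' ` (A \<union> B)"
      using assms(1) insert.hyps(1) finite_subset by blast
    then obtain i where i: "2 * int i \<notin> f' ` (A \<union> B)" by blast
    have "b \<notin> A \<union> B" using False insert.hyps(2) by simp
    then have "inj_on (f'(b := 2 * int i)) (insert b (A \<union> B))"
      using inj_on_fun_updI[OF f'(1)] i by (simp add: inj_on_fun_updI) blast
    then have "inj_on (f'(b := 2 * int i)) (A \<union> insert b B)" by simp
    moreover have "\<forall>x\<in>A. (f'(b := 2 * int i)) x = f x" using f'(2) False by auto
    moreover have "\<forall>x\<in>insert b B - A. even ((f'(b := 2 * int i)) x)" using f'(3) by auto
    ultimately show ?thesis by blast
  qed
qed

lemma embed_two_edges:
  assumes "a \<noteq> b" "c \<noteq> (e :: int)"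
  obtains f :: "int \<Rightarrow> int" where "inj_on f {a, b, c, e}" "\<And>x. even (f x)"
    "\<bar>f b - f a\<bar> = 2" "\<bar>f e - f c\<bar> = 2"
proof -
  consider "a = c" "b = e" | "a = e" "b = c" | "a = c" "b \<noteq> e" | "a = e" "b \<noteq> c"
    | "b = c" "a \<noteq> e" | "b = e" "a \<noteq> c" | "a \<notin> {c, e}" "b \<notin> {c, e}" by blast
  then show thesis
  proof cases
    case 1 then show ?thesis using assms by (intro that[of "(\<lambda>_. 0)(b := 2)"]) auto
  next
    case 2 then show ?thesis using assms by (intro that[of "(\<lambda>_. 0)(b := 2)"]) auto
  next
    case 3 then show ?thesis using assms by (intro that[of "(\<lambda>_. 0)(b := 2, e := - 2)"]) auto
  next
    case 4 then show ?thesis using assms by (intro that[of "(\<lambda>_. 0)(b := 2, c := - 2)"]) auto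
  next
    case 5 then show ?thesis using assms by (intro that[of "(\<lambda>_. 0)(a := 2, e := - 2)"]) auto
  next
    case 6 then show ?thesis using assms by (intro that[of "(\<lambda>_. 0)(a := 2, c := - 2)"]) auto
  next
    case 7 then show ?thesis using assms by (intro that[of "(\<lambda>_. 0)(b := 2, c := 4, e := 6)"]) auto
  qed
qed

text \<open>
  Points \<open>q1, q2\<close> moved by \<open>g1, g2\<close> are placed at odd numbers and all other moved points at
  even ones. Each \<open>q\<close> should be the only odd moved point of its own permutation, so the two are
  taken equal whenever the supports meet. The arrows at \<open>u1, u2\<close>, which avoid \<open>q1, q2\<close>,
  become steps of length \<open>2\<close>, and the arrow that ends in \<open>q1\<close> or \<open>q2\<close> leads from an even to an
  odd number.
\<close>

lemma prepared_finitary_pair: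
  assumes g1: "even_translation 0 g1" "g1 \<noteq> id" and g2: "even_translation 0 g2" "g2 \<noteq> id"
  obtains S f where "finite S" "inj_on f S" "prepared g1 0 S f" "prepared g2 0 S f"
proof -
  have moved: "\<exists>q. g q \<noteq> q" if "g \<noteq> id" for g :: "int \<Rightarrow> int" using that by auto
  obtain q1 q2 where q: "g1 q1 \<noteq> q1" "g2 q2 \<noteq> q2" "q1 = q2 \<or> (\<forall>x. g1 x = x \<or> g2 x = x)"
    using moved[OF g1(2)] moved[OF g2(2)] by blast
  have inj: "inj g1" "inj g2" using g1 g2 even_translation_bij bij_is_inj by blast+
  obtain u1 where u1: "g1 u1 \<noteq> u1" "u1 \<noteq> q1" "g1 u1 \<noteq> q1" by (rule even_translation_0_edge[OF g1])
  obtain u2 where u2: "g2 u2 \<noteq> u2" "u2 \<noteq> q2" "g2 u2 \<noteq> q2" by (rule even_translation_0_edge[OF g2])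
  have u12: "u1 \<noteq> q2" "g1 u1 \<noteq> q2" "u2 \<noteq> q1" "g2 u2 \<noteq> q1"
    using q u1 u2 inj by (metis injD)+
  obtain f0 :: "int \<Rightarrow> int" where f0: "inj_on f0 {u1, g1 u1, u2, g2 u2}" "\<And>x. even (f0 x)"
    "\<bar>f0 (g1 u1) - f0 u1\<bar> = 2" "\<bar>f0 (g2 u2) - f0 u2\<bar> = 2"
    using embed_two_edges[of u1 "g1 u1" u2 "g2 u2"] u1(1) u2(1) by metis
  let ?E = "{u1, g1 u1, u2, g2 u2}"
  let ?f1 = "f0(q2 := 3, q1 := 1)"
  have odd13: "f0 x \<noteq> 1" "f0 x \<noteq> 3" for x using f0(2)[of x] by auto
  have inj_f1: "inj_on ?f1 (?E \<union> {q1, q2})"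
    using f0(1) u1 u2 u12 odd13 odd13[symmetric] by (auto simp: inj_on_def)
  let ?T = "{x. g1 x \<noteq> x} \<union> {x. g2 x \<noteq> x}"
  have T: "finite ?T"
    using g1(1) g2(1) permutation_finite_support[of g1] permutation_finite_support[of g2]
    by (simp add: even_translation_def shift_0)
  have "finite (?E \<union> {q1, q2})" by simp
  from inj_on_extend_even[OF this T inj_f1]
  obtain f where f: "inj_on f ((?E \<union> {q1, q2}) \<union> ?T)"
    "\<forall>x\<in>?E \<union> {q1, q2}. f x = ?f1 x" "\<forall>x\<in>?T - (?E \<union> {q1, q2}). even (f x)"
    by (elim exE conjE)
  have fq: "odd (f q1)" "odd (f q2)" using f(2) by auto
  have odd_f: "x = q1 \<or> x = q2" if "x \<in> ?T" "odd (f x)" for x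
  proof (rule ccontr)
    assume *: "\<not> (x = q1 \<or> x = q2)"
    show False
    proof (cases "x \<in> ?E")
      case True
      then have "x \<in> ?E \<union> {q1, q2}" by blast
      then have "f x = ?f1 x" using f(2) by blast
      then have "f x = f0 x" using * by simp
      then show False using that(2) f0(2) by simp
    next
      case False
      then show False using f(3) * that by blast
    qed
  qed
  let ?S = "(?E \<union> {q1, q2}) \<union> ?T"
  have prep: "prepared g 0 ?S f"
    if g: "inj g" "surj g" "{x. g x \<noteq> x} \<subseteq> ?T" "u \<in> ?S" "g u \<in> ?S" "even (f u)" "\<bar>f (g u) - f u\<bar> = 2"
      "g q \<noteq> q" "odd (f q)" "\<And>x. g x \<noteq> x \<Longrightarrow> odd (f x) \<Longrightarrow> x = q" for g u q
  proof -
    obtain w where w: "g w = q" using g(2) by (metis surjD)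
    then have "w \<noteq> q" using g(8) by auto
    then have "g w \<noteq> w" using w by auto
    then have "even (f w)" using g(10) \<open>w \<noteq> q\<close> by blast
    have "g q \<noteq> q" by fact
    then have "w \<in> ?T" "q \<in> ?T" using g(3) \<open>g w \<noteq> w\<close> by blast+
    then have "w \<in> ?S" "g w \<in> ?S" using w by blast+
    then have "\<exists>w\<in>?S. g w \<in> ?S \<and> even (f w) \<and> odd (f (g w) - 0)"
      using \<open>even (f w)\<close> w g(9) by (intro bexI[of _ w]) simp_all
    moreover have "\<exists>w\<in>?S. g w \<in> ?S \<and> even (f w) \<and> \<bar>f (g w) - f w - 0\<bar> = 2"
      using g(5-7) by (intro bexI[OF _ g(4)]) simp
    moreover have "{x. g x \<noteq> x} \<subseteq> ?S" using g(3) by blast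
    moreover have "\<exists>q. \<forall>x. g x \<noteq> x \<longrightarrow> odd (f x) \<longrightarrow> x = q" using g(10) by (intro exI[of _ q]) simp
    ultimately show ?thesis unfolding prepared_def by (intro conjI impI)
  qed
  have surj: "surj g1" "surj g2" using g1 g2 even_translation_bij bij_is_surj by blast+
  have fE: "f u1 = f0 u1" "f (g1 u1) = f0 (g1 u1)" "f u2 = f0 u2" "f (g2 u2) = f0 (g2 u2)"
    using f(2) u1 u2 u12 by auto
  have p1: "prepared g1 0 ?S f"
  proof (rule prep[of g1 u1 q1])
    show "x = q1" if "g1 x \<noteq> x" "odd (f x)" for x using odd_f[of x] that q by auto
  qed (use inj surj fE f0 fq q in auto)
  have p2: "prepared g2 0 ?S f"
  proof (rule prep[of g2 u2 q2])
    show "x = q2" if "g2 x \<noteq> x" "odd (f x)" for x using odd_f[of x] that q by auto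
  qed (use inj surj fE f0 fq q in auto)
  have "finite ?S" using T by simp
  then show thesis by (rule that[OF _ f(1) p1 p2])
qed

text \<open>
  Far out \<open>g\<close> is a translation, so two of its arrows can be found that avoid each other and any
  given finite set, and their end points may be given arbitrary fresh values.
\<close>

lemma prepared_extend:
  assumes g: "even_translation k g" "k \<noteq> 0" and S: "finite S" "inj_on f S"
  obtains S' f' where "finite S'" "inj_on f' S'" "S \<subseteq> S'" "\<And>x. x \<in> S \<Longrightarrow> f' x = f x" "prepared g k S' f'"
proof -
  obtain L where L: "L \<ge> 0" "\<And>z. \<bar>z\<bar> > L \<Longrightarrow> g z = z + k"
    using even_translation_far[OF g(1)] by blast
  define M where "M = Max (insert L (abs ` (S \<union> f ` S)))"
  have M: "\<bar>x\<bar> \<le> M" if "x \<in> S \<union> f ` S" for x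
    unfolding M_def using that S(1) by (intro Max_ge) auto
  have L_le: "L \<le> M" unfolding M_def using S(1) by (intro Max_ge) auto
  define r where "r = M + \<bar>k\<bar> + 1"
  define a where "a = 2 * (M + \<bar>k\<bar> + 2)"
  define b where "b = a + 4 * \<bar>k\<bar> + 10"
  \<comment> \<open>With the sign of \<open>k\<close>, the values \<open>a + k + 2 s\<close> and \<open>b + k + s\<close> differ from \<open>a\<close> and \<open>b\<close>.\<close>
  define s :: int where "s = (if k > 0 then 1 else - 1)"
  let ?P = "{r, r + k, r + 2 * \<bar>k\<bar>, r + 2 * \<bar>k\<bar> + k}"
  define f' where "f' = f(r := a, r + k := a + k + 2 * s, r + 2 * \<bar>k\<bar> := b, r + 2 * \<bar>k\<bar> + k := b + k + s)"
  have far: "x > M" if "x \<in> ?P" for x using that unfolding r_def by auto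
  have notS: "x \<notin> S" if "x \<in> ?P" for x using far[OF that] M[of x] by auto
  have dist: "distinct [r, r + k, r + 2 * \<bar>k\<bar>, r + 2 * \<bar>k\<bar> + k]" using g(2) by (auto simp: abs_if)
  have f'P: "f' r = a" "f' (r + k) = a + k + 2 * s" "f' (r + 2 * \<bar>k\<bar>) = b" "f' (r + 2 * \<bar>k\<bar> + k) = b + k + s"
    using dist unfolding f'_def by auto
  have f'S: "f' x = f x" if "x \<in> S" for x
    using notS that unfolding f'_def by auto
  have gP: "g r = r + k" "g (r + 2 * \<bar>k\<bar>) = r + 2 * \<bar>k\<bar> + k"
    using L L_le far[of r] far[of "r + 2 * \<bar>k\<bar>"] by simp_all
  have M0: "M \<ge> 0" using L L_le by simp
  have valP: "f' x > M" if "x \<in> ?P" for x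
    using that f'P M0 unfolding a_def b_def s_def by auto
  have "inj_on f' ?P"
    using f'P g(2) unfolding b_def s_def by (auto simp: inj_on_def split: if_splits)
  moreover have "inj_on f' S" using S(2) f'S by (simp add: inj_on_def)
  moreover have "f' x \<noteq> f' z" if "x \<in> S" "z \<in> ?P" for x z
    using valP[OF that(2)] M[of "f x"] f'S[OF that(1)] that(1) by auto
  ultimately have inj: "inj_on f' (S \<union> ?P)"
    unfolding inj_on_def by (metis UnE)
  have "prepared g k (S \<union> ?P) f'"
    unfolding prepared_def
  proof (intro conjI impI)
    show "\<exists>w\<in>S \<union> ?P. g w \<in> S \<union> ?P \<and> even (f' w) \<and> \<bar>f' (g w) - f' w - k\<bar> = 2"
      using gP(1) f'P(1,2) by (intro bexI[of _ r]) (simp_all add: a_def s_def)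
    show "\<exists>w\<in>S \<union> ?P. g w \<in> S \<union> ?P \<and> even (f' w) \<and> odd (f' (g w) - k)"
      using gP(2) f'P(3,4) by (intro bexI[of _ "r + 2 * \<bar>k\<bar>"]) (simp_all add: a_def b_def s_def)
  qed (use g(2) in simp_all)
  then show thesis by (intro that[of "S \<union> ?P" f'] inj f'S) (use S(1) in auto)
qed

lemma prepared_pair:
  assumes g1: "even_translation k1 g1" "g1 \<noteq> id" and g2: "even_translation k2 g2" "g2 \<noteq> id"
  obtains S f where "finite S" "inj_on f S" "prepared g1 k1 S f" "prepared g2 k2 S f"
proof -
  have single: "\<exists>S f. finite S \<and> inj_on f S \<and> prepared g k S f"
    if g: "even_translation k g" "g \<noteq> id" for g k
  proof (cases "k = 0")
    case True
    then show ?thesis using prepared_finitary_pair[of g g] g by metis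
  next
    case False
    then show ?thesis using prepared_extend[OF g(1), of "{}" "\<lambda>x. x"] by (metis finite.emptyI inj_on_empty)
  qed
  have pair: "\<exists>S f. finite S \<and> inj_on f S \<and> prepared g k S f \<and> prepared h l S f"
    if g: "even_translation k g" "g \<noteq> id" and h: "even_translation l h" "l \<noteq> 0" for g h k l
  proof -
    obtain S f where S: "finite S" "inj_on f S" "prepared g k S f" using single[OF g] by blast
    obtain S' f' where "finite S'" "inj_on f' S'" "S \<subseteq> S'" "\<And>x. x \<in> S \<Longrightarrow> f' x = f x" "prepared h l S' f'"
      using prepared_extend[OF h S(1,2)] by blast
    moreover have "prepared g k S' f'" using prepared_mono[OF S(3)] calculation by blast
    ultimately show ?thesis by blast
  qed
  consider "k1 = 0" "k2 = 0" | "k2 \<noteq> 0" | "k1 \<noteq> 0" by blast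
  then show thesis
  proof cases
    case 1 then show ?thesis using prepared_finitary_pair[of g1 g2] g1 g2 that by metis
  next
    case 2 then show ?thesis using pair[OF g1 g2(1)] that by blast
  next
    case 3 then show ?thesis using pair[OF g2 g1(1)] that by blast
  qed
qed

section \<open>Generation after a relabelling\<close>

text \<open>
  The steps required by \<open>linked_all_if_steps\<close> come from \<open>prepared\<close>. The remaining work is to find
  a shift \<open>d\<close> such that the support of \<open>h\<close> and its translate by \<open>d\<close> share exactly one point \<open>p\<close>;
  their commutator is then a three-cycle.

  If \<open>k = 0\<close>, take the distance between the extreme even points of the support: two even points of
  the support are at distance \<open>d\<close> only if they are these two, and at most one point is odd.
  If \<open>k > 0\<close>, the extreme points of the support are \<open>A - k\<close> and \<open>B\<close>, and if \<open>k < 0\<close> they are \<open>A\<close>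
  and \<open>B - k\<close>; their distance is divisible by \<open>n\<close> because \<open>A\<close> and \<open>B\<close> are even.
\<close>

lemma (in int_perm_group) linked_if_prepared:
  fixes g y :: "int \<Rightarrow> int" and k A B L :: int
  defines "h \<equiv> shift (- k) \<circ> y \<circ> g \<circ> perm_inv y"
  assumes h: "h \<in> H" and n: "shift n \<in> H" "n dvd 2" "n dvd k"
    and y: "bij y" and g: "bij g" "\<And>z. \<bar>z\<bar> > L \<Longrightarrow> g z = z + k"
    and prep: "prepared g k S f" "finite S" "\<And>x. x \<in> S \<Longrightarrow> y x = f x"
    and ext: "even A" "even B" "A < - L" "L < B" "L \<ge> 0" "y A \<noteq> A" "y B \<noteq> B"
      "\<And>z. z < A \<or> B < z \<Longrightarrow> y z = z"
  shows "linked a b"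
proof -
  have ye: "y x = y z \<longleftrightarrow> x = z" and ge: "g x = g z \<longleftrightarrow> x = z" for x z
    using y g(1) by (auto simp: bij_def inj_eq)
  have h_y: "h (y w) = y (g w) - k" for w
    by (simp add: h_def shift_def bij_inv_apply[OF y])
  have Y: "y (perm_inv y z) = z" "perm_inv y (y z) = z" for z
    using bij_inv_apply[OF y] bij_apply_inv[OF y] by auto
  have h_fix: "h z = z \<longleftrightarrow> y (g (perm_inv y z)) = z + k" for z
    by (auto simp: h_def shift_def)
  have Y_fix: "perm_inv y z = z" if "z < A \<or> B < z" for z
    using ext(8)[OF that] Y(2) by metis
  have h_left: "h z = z" if "z < A" "z + k < A" for z
    using that ext(3,5,8) g(2)[of z] by (simp add: h_fix Y_fix)
  have h_right: "h z = z" if "z > B" "z + k > B" for z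
    using that ext(4,5,8) g(2)[of z] by (simp add: h_fix Y_fix)
  have "{z. h z \<noteq> z} \<subseteq> {A - \<bar>k\<bar>..B + \<bar>k\<bar>}"
    using h_left h_right by force
  then have fin: "finite {z. h z \<noteq> z}" by (rule finite_subset) simp
  obtain u where u: "u \<in> S" "g u \<in> S" "even (f u)" "\<bar>f (g u) - f u - k\<bar> = 2"
    using prep(1) unfolding prepared_def by auto
  obtain v where v: "v \<in> S" "g v \<in> S" "even (f v)" "odd (f (g v) - k)"
    using prep(1) unfolding prepared_def by auto
  have step: "even (y u)" "\<bar>h (y u) - y u\<bar> = 2"
    using u(3,4) h_y[of u] prep(3)[OF u(1)] prep(3)[OF u(2)] by (simp_all add: algebra_simps)
  have cross: "even (y v)" "odd (h (y v))"
    using v(3,4) h_y[of v] prep(3)[OF v(1)] prep(3)[OF v(2)] by simp_all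
  have "\<exists>d p. n dvd d \<and> h p \<noteq> p \<and> h (p - d) \<noteq> p - d \<and>
      (\<forall>z. h z \<noteq> z \<longrightarrow> h (z - d) \<noteq> z - d \<longrightarrow> z = p)"
  proof -
    consider "k = 0" | "k > 0" | "k < 0" by linarith
    then show ?thesis
    proof cases
      case 1
      obtain q where q: "\<And>x. g x \<noteq> x \<Longrightarrow> odd (f x) \<Longrightarrow> x = q" and S: "{x. g x \<noteq> x} \<subseteq> S"
        using prep(1) 1 unfolding prepared_def by blast
      have h_fix0: "h z = z \<longleftrightarrow> g (perm_inv y z) = perm_inv y z" for z
      proof -
        have "h z = z \<longleftrightarrow> y (g (perm_inv y z)) = y (perm_inv y z)" using 1 h_fix[of z] Y(1)[of z] by simp
        then show ?thesis by (simp only: ye)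
      qed
      have odd_q: "z = y q" if "h z \<noteq> z" "odd z" for z
      proof -
        let ?x = "perm_inv y z"
        have x: "g ?x \<noteq> ?x" using that h_fix0 by simp
        then have "?x \<in> S" using S by blast
        then have "odd (f ?x)" using prep(3)[of ?x] that(2) Y(1)[of z] by simp
        then have "?x = q" using x by (intro q)
        then show ?thesis using Y(1)[of z] by simp
      qed
      define E where "E = {z. h z \<noteq> z \<and> even z}"
      have E: "finite E" using fin by (rule rev_finite_subset) (auto simp: E_def)
      have "y u \<in> E" using step by (auto simp: E_def)
      then have ne: "E \<noteq> {}" by blast
      have M: "Max E \<in> E" "Min E \<in> E" using E ne by auto
      have "y (g u) \<in> E"
      proof -
        have "g u \<noteq> u" using u(4) 1 by auto
        then have "h (y (g u)) \<noteq> y (g u)" using 1 by (simp add: h_y ye ge)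
        moreover have "even (y (g u))" using u 1 prep(3) by (simp add: abs_if split: if_splits) presburger+
        ultimately show ?thesis by (simp add: E_def)
      qed
      moreover have "y (g u) \<noteq> y u" using step 1 h_y by auto
      ultimately have "Max E \<noteq> Min E"
        using \<open>y u \<in> E\<close> E by (metis Max_ge Min_le order_antisym order_trans)
      moreover have "Max E \<ge> Min E" using E M by simp
      ultimately have d: "Max E - Min E > 0" "even (Max E - Min E)"
        using M by (auto simp: E_def)
      show ?thesis
      proof (rule exI[of _ "Max E - Min E"], rule exI[of _ "Max E"], intro conjI allI impI)
        show "n dvd Max E - Min E" using d(2) n(2) dvd_trans by blast
        show "h (Max E) \<noteq> Max E" using M by (simp add: E_def)
        show "h (Max E - (Max E - Min E)) \<noteq> Max E - (Max E - Min E)" using M by (simp add: E_def)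
      next
        fix z assume z: "h z \<noteq> z" "h (z - (Max E - Min E)) \<noteq> z - (Max E - Min E)"
        show "z = Max E"
        proof (cases "even z")
          case True
          then have "z \<in> E" "z - (Max E - Min E) \<in> E" using z d(2) by (auto simp: E_def)
          then have "z \<le> Max E" "Min E \<le> z - (Max E - Min E)" using E by simp_all
          then show ?thesis by simp
        next
          case False
          then have "odd (z - (Max E - Min E))" using d(2) by simp
          then have "z = y q" "z - (Max E - Min E) = y q"
            using odd_q[OF z(1) False] odd_q[OF z(2)] by blast+
          then show ?thesis using d(1) by linarith
        qed
      qed
    next
      case 2
      have B: "h B \<noteq> B"
      proof
        assume "h B = B"
        then have "y (g (perm_inv y B)) = B + k" by (simp add: h_fix)
        also have "\<dots> = y (B + k)" using ext(8) 2 by simp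
        also have "B + k = g B" using g(2) ext(4,5) by simp
        finally have "perm_inv y B = B" by (simp add: ye ge)
        then show False using Y(1)[of B] ext(7) by simp
      qed
      have A: "h (A - k) \<noteq> A - k"
        using 2 g(2)[of "A - k"] ext(3,5,6) by (simp add: h_fix Y_fix)
      show ?thesis
      proof (rule exI[of _ "B - A + k"], rule exI[of _ B], intro conjI allI impI B)
        show "n dvd B - A + k" using n ext(1,2) by (meson dvd_add dvd_diff dvd_trans)
        show "h (B - (B - A + k)) \<noteq> B - (B - A + k)" using A by simp
      next
        fix z assume z: "h z \<noteq> z" "h (z - (B - A + k)) \<noteq> z - (B - A + k)"
        then show "z = B"
          using h_right[of z] h_left[of "z - (B - A + k)"] 2 by force
      qed
    next
      case 3
      have A: "h A \<noteq> A"
      proof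
        assume "h A = A"
        then have "y (g (perm_inv y A)) = A + k" by (simp add: h_fix)
        also have "\<dots> = y (A + k)" using ext(8) 3 by simp
        also have "A + k = g A" using g(2) ext(3,5) by simp
        finally have "perm_inv y A = A" by (simp add: ye ge)
        then show False using Y(1)[of A] ext(6) by simp
      qed
      have B: "h (B - k) \<noteq> B - k"
        using 3 g(2)[of "B - k"] ext(4,5,7) by (simp add: h_fix Y_fix)
      show ?thesis
      proof (rule exI[of _ "B - A - k"], rule exI[of _ "B - k"], intro conjI allI impI B)
        show "n dvd B - A - k" using n ext(1,2) by (meson dvd_diff dvd_trans)
        show "h (B - k - (B - A - k)) \<noteq> B - k - (B - A - k)" using A by simp
      next
        fix z assume z: "h z \<noteq> z" "h (z - (B - A - k)) \<noteq> z - (B - A - k)"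
        then show "z = B - k"
          using h_right[of z] h_left[of "z - (B - A - k)"] 3 by force
      qed
    qed
  qed
  then obtain d p where d: "n dvd d" "h p \<noteq> p" "h (p - d) \<noteq> p - d"
    "\<And>z. h z \<noteq> z \<Longrightarrow> h (z - d) \<noteq> z - d \<Longrightarrow> z = p" by blast
  let ?h = "shift d \<circ> h \<circ> perm_inv (shift d)"
  have h': "?h \<in> H" using h shift_multiple[OF n(1) d(1)] by (intro conj)
  have h'_apply: "?h z = h (z - d) + d" for z by (simp add: perm_inv_shift shift_def)
  have h'_fix: "?h z \<noteq> z \<longleftrightarrow> h (z - d) \<noteq> z - d" for z unfolding h'_apply by auto
  have "cyc3 (?h p) p (h p) \<in> H" "distinct [?h p, p, h p]"
    using commutator_cyc3[OF h h', of p] d(2,3,4) h'_fix by blast+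
  then show ?thesis
    using linked_all_if_steps[OF shift_multiple[OF n(1,2)] h fin _ _ step cross] by blast
qed

section \<open>The uniform spread is at least two\<close>

text \<open>
  With \<open>y\<close> relabelling both elements suitably, the common mate is the conjugate \<open>h\<close> of \<open>shift n\<close>
  that \<open>y\<close> turns back into \<open>shift n\<close>.
\<close>

lemma uniform_spread_Gn:
  assumes n: "n dvd 2"
  shows "uniform_spread (Gn n) \<ge> 2"
proof -
  let ?G = "carrier (Gn n)"
  interpret G: int_perm_group ?G by (rule int_perm_group_Gn)
  have grp: "group (Gn n)" by (simp add: Gn_def group.group_subgroup_generated[OF group_SymZ])
  have mult: "f \<otimes>\<^bsub>Gn n\<^esub> g = g \<circ> f" for f g
    by (simp add: Gn_def SymZ_mult)
  have inv: "inv\<^bsub>Gn n\<^esub> f = perm_inv f" if "f \<in> ?G" for f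
    using group.inv_subgroup_generated[OF group_SymZ] that G.bij[OF that] by (simp add: Gn_def SymZ_inv)
  have one: "\<one>\<^bsub>Gn n\<^esub> = id" by (simp add: Gn_def SymZ_one)
  let ?C = "conjugacy_class (Gn n) (shift n)"
  have "\<exists>h\<in>?C. \<forall>i<2. generate (Gn n) {g i, h} = ?G"
    if g: "\<forall>i<2::nat. g i \<in> ?G - {\<one>\<^bsub>Gn n\<^esub>}" for g
  proof -
    have g01: "g 0 \<in> ?G" "g 0 \<noteq> id" "g 1 \<in> ?G" "g 1 \<noteq> id" using g one by auto
    obtain k0 where k0: "n dvd k0" "even_translation k0 (g 0)" by (rule even_translation_Gn[OF g01(1)])
    obtain k1 where k1: "n dvd k1" "even_translation k1 (g 1)" by (rule even_translation_Gn[OF g01(3)])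
    obtain L0 where L0: "L0 \<ge> 0" "\<And>z. \<bar>z\<bar> > L0 \<Longrightarrow> g 0 z = z + k0"
      using even_translation_far[OF k0(2)] by blast
    obtain L1 where L1: "L1 \<ge> 0" "\<And>z. \<bar>z\<bar> > L1 \<Longrightarrow> g 1 z = z + k1"
      using even_translation_far[OF k1(2)] by blast
    obtain S f where S: "finite S" "inj_on f S" "prepared (g 0) k0 S f" "prepared (g 1) k1 S f"
      by (rule prepared_pair[OF k0(2) g01(2) k1(2) g01(4)])
    obtain y A B where y: "y \<in> ?G" "\<And>x. x \<in> S \<Longrightarrow> y x = f x"
      and AB: "even A" "even B" "A < - max L0 L1" "max L0 L1 < B" "y A \<noteq> A" "y B \<noteq> B"
      "\<And>z. z < A \<or> B < z \<Longrightarrow> y z = z"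
      using G.exists_mem_extending_far[OF cyc3_mem_Gn[OF n] S(1,2), where L = "max L0 L1"] by blast
    have bij_y: "bij y" by (rule G.bij[OF y(1)])
    define h where "h = perm_inv y \<circ> shift n \<circ> y"
    have h: "h \<in> ?G" unfolding h_def by (intro G.comp G.inverse y shift_mem_Gn)
    have yy: "perm_inv (perm_inv y) = y" by (rule inv_inv_eq[OF bij_y])
    have "h = inv\<^bsub>Gn n\<^esub> (perm_inv y) \<otimes>\<^bsub>Gn n\<^esub> shift n \<otimes>\<^bsub>Gn n\<^esub> perm_inv y"
      using inv[OF G.inverse[OF y(1)]] by (simp add: mult h_def yy comp_assoc)
    then have "h \<in> ?C" unfolding conjugacy_class_def using G.inverse[OF y(1)] by blast
    moreover have "generate (Gn n) {u, h} = ?G"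
      if u: "u \<in> ?G" "even_translation k u" "n dvd k" "prepared u k S f"
        "\<And>z. \<bar>z\<bar> > max L0 L1 \<Longrightarrow> u z = z + k" for u k
    proof
      show "generate (Gn n) {u, h} \<subseteq> ?G"
        using u(1) h by (intro group.generate_incl[OF grp]) auto
      have sub: "{u, h} \<subseteq> ?G" using u(1) h by simp
      let ?K = "generate SymZ {u, h}"
      have K: "generate (Gn n) {u, h} = ?K" by (rule generate_Gn[OF sub])
      have "{u, h} \<subseteq> carrier SymZ" using sub G.bij by (auto simp: SymZ_carrier)
      then have "int_perm_group ?K" by (rule int_perm_group_generate)
      \<comment> \<open>The relabelled group, in which \<open>h\<close> becomes \<open>shift n\<close>.\<close>
      let ?H = "{f. bij f \<and> perm_inv y \<circ> f \<circ> y \<in> ?K}"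
      interpret H: int_perm_group ?H by (rule int_perm_group_conj[OF \<open>int_perm_group ?K\<close> bij_y])
      have in_H: "y \<circ> f \<circ> perm_inv y \<in> ?H \<longleftrightarrow> f \<in> ?K" if "bij f" for f
      proof -
        have "perm_inv y \<circ> (y \<circ> f \<circ> perm_inv y) \<circ> y = f"
          by (simp add: fun_eq_iff bij_inv_apply[OF bij_y])
        moreover have "bij (y \<circ> f \<circ> perm_inv y)"
          by (intro bij_comp bij_imp_bij_inv bij_y that)
        ultimately show ?thesis by simp
      qed
      have shift_H: "shift n \<in> ?H"
        using generate.incl[of h "{u, h}" SymZ] by (simp add: bij_shift h_def)
      have "y \<circ> u \<circ> perm_inv y \<in> ?H"
        using in_H[OF G.bij[OF u(1)]] generate.incl[of u "{u, h}" SymZ] by simp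
      moreover have "shift (- k) \<in> ?H" using H.shift_multiple[OF shift_H, of "- k"] u(3) by simp
      ultimately have "shift (- k) \<circ> (y \<circ> u \<circ> perm_inv y) \<in> ?H" by (rule H.comp[rotated])
      then have "shift (- k) \<circ> y \<circ> u \<circ> perm_inv y \<in> ?H" by (simp only: comp_assoc)
      then have "H.linked a b" for a b
        using H.linked_if_prepared[OF _ shift_H n u(3) bij_y G.bij[OF u(1)] u(5) u(4) S(1) y(2) AB(1-4) _ AB(5-7)]
          L0(1) by simp
      then have "cyc3 1 2 3 \<in> ?H" by (rule H.all_cyc3_mem) simp
      then have GH: "?G \<subseteq> ?H" using Gn_subset[OF H.int_perm_group_axioms] shift_H by blast
      show "?G \<subseteq> generate (Gn n) {u, h}"
      proof
        fix f assume f: "f \<in> ?G"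
        then have "y \<circ> f \<circ> perm_inv y \<in> ?H" using GH G.conj[OF y(1)] by blast
        then show "f \<in> generate (Gn n) {u, h}" using in_H[OF G.bij[OF f]] K by simp
      qed
    qed
    then have "generate (Gn n) {g 0, h} = ?G" "generate (Gn n) {g 1, h} = ?G"
      using g01 k0 k1 S(3,4) L0(2) L1(2) by simp_all
    ultimately show ?thesis by (auto simp: less_2_cases_iff)
  qed
  then have "enat 2 \<le> spread_on (Gn n) ?C"
    unfolding spread_on_def by (intro Sup_upper) blast
  also have "\<dots> \<le> uniform_spread (Gn n)"
    unfolding uniform_spread_def using shift_mem_Gn by (intro Sup_upper) blast
  finally show ?thesis by (simp add: numeral_eq_enat)
qed

section \<open>The spread is at most nine\<close>

text \<open>
  The stabiliser of the partition into \<open>X\<close> and its complement.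
\<close>

definition block_stabiliser :: "int set \<Rightarrow> (int \<Rightarrow> int) set" where
  "block_stabiliser X =
     {f. bij f \<and> ((\<forall>z. f z \<in> X \<longleftrightarrow> z \<in> X) \<or> (\<forall>z. f z \<in> X \<longleftrightarrow> z \<notin> X))}"

lemma int_perm_group_block_stabiliser: "int_perm_group (block_stabiliser X)"
proof (rule int_perm_groupI)
  fix f g assume "f \<in> block_stabiliser X" "g \<in> block_stabiliser X"
  then show "f \<circ> g \<in> block_stabiliser X"
    unfolding block_stabiliser_def using bij_comp[of g f] by auto
next
  fix f assume f: "f \<in> block_stabiliser X"
  then have "bij f" by (simp add: block_stabiliser_def)
  have "(\<forall>z. f z \<in> X \<longleftrightarrow> z \<in> X) \<or> (\<forall>z. f z \<in> X \<longleftrightarrow> z \<notin> X)"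
    using f by (simp add: block_stabiliser_def)
  then have "(\<forall>z. perm_inv f z \<in> X \<longleftrightarrow> z \<in> X) \<or> (\<forall>z. perm_inv f z \<in> X \<longleftrightarrow> z \<notin> X)"
    using bij_apply_inv[OF \<open>bij f\<close>] by metis
  then show "perm_inv f \<in> block_stabiliser X"
    using bij_imp_bij_inv[OF \<open>bij f\<close>] by (simp add: block_stabiliser_def)
qed (auto simp: block_stabiliser_def)

text \<open>
  A three-cycle has a fixed point, so it cannot exchange the two sides.
\<close>

lemma cyc3_notin_block_stabiliser:
  assumes "x \<in> X" "y \<notin> X" "distinct [x, y, z]"
  shows "cyc3 x y z \<notin> block_stabiliser X"
proof
  assume c: "cyc3 x y z \<in> block_stabiliser X"
  obtain p where "p \<notin> {x, y, z}" using ex_new_if_finite[OF infinite_UNIV_int, of "{x, y, z}"] by auto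
  then have "cyc3 x y z p = p" by (simp add: cyc3_fixes)
  then have "\<not> (\<forall>v. cyc3 x y z v \<in> X \<longleftrightarrow> v \<notin> X)" by metis
  then have "cyc3 x y z x \<in> X \<longleftrightarrow> x \<in> X" using c by (auto simp: block_stabiliser_def)
  then show False using assms by (simp add: cyc3_def)
qed

text \<open>
  Consider the orbit of \<open>0\<close>, split into the points reached by even and by odd powers of \<open>h\<close>. If
  the orbit is not everything, \<open>h\<close> preserves it as a proper subset. If it is everything and the two parts are disjoint,
  \<open>h\<close> exchanges them. If the parts overlap, some positive power of \<open>h\<close> fixes \<open>0\<close>, and the orbit is
  finite.
\<close>

lemma exists_block:
  assumes h: "bij (h :: int \<Rightarrow> int)"
  obtains X where "X \<noteq> {}" "X \<noteq> UNIV" "h \<in> block_stabiliser X"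
proof -
  have inj: "inj h" using h by (rule bij_is_inj)
  \<comment> \<open>\<open>(h ^^ i) z = (h ^^ m) 0\<close> says that \<open>z\<close> is the image of \<open>0\<close> under the integer power
    \<open>m - i\<close> of \<open>h\<close>; the parity of the exponent is that of \<open>i + m\<close>.\<close>
  define R where "R par = {z. \<exists>i m. (even (i + m) \<longleftrightarrow> par) \<and> (h ^^ i) z = (h ^^ m) 0}" for par
  have flip: "h z \<in> R par \<longleftrightarrow> z \<in> R (\<not> par)" for z par
  proof
    assume "h z \<in> R par"
    then obtain i m where im: "even (i + m) \<longleftrightarrow> par" "(h ^^ i) (h z) = (h ^^ m) 0" by (auto simp: R_def)
    then show "z \<in> R (\<not> par)"
      unfolding R_def by (intro CollectI exI[of _ "Suc i"] exI[of _ m]) (simp add: funpow_swap1)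
  next
    assume "z \<in> R (\<not> par)"
    then obtain i m where im: "even (i + m) \<longleftrightarrow> \<not> par" "(h ^^ i) z = (h ^^ m) 0" by (auto simp: R_def)
    then have "(h ^^ i) (h z) = (h ^^ Suc m) 0" by (simp add: funpow_swap1[symmetric])
    then show "h z \<in> R par"
      unfolding R_def using im(1) by (intro CollectI exI[of _ i] exI[of _ "Suc m"]) auto
  qed
  have zero: "0 \<in> R True" unfolding R_def by (intro CollectI exI[of _ 0]) simp
  consider "R True \<union> R False \<noteq> UNIV" | "R True \<inter> R False = {}" "R True \<union> R False = UNIV"
    | z where "z \<in> R True" "z \<in> R False" by blast
  then show thesis
  proof cases
    case 1
    show ?thesis
      by (rule that[of "R True \<union> R False"]) (use zero 1 h flip in \<open>auto simp: block_stabiliser_def\<close>)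
  next
    case 2
    have "R True \<noteq> UNIV" using flip[of 0 False] zero 2 by auto
    moreover have "h \<in> block_stabiliser (R True)"
      using flip[of _ True] 2 h unfolding block_stabiliser_def by auto
    ultimately show ?thesis using that zero by blast
  next
    case 3
    obtain i m where im: "even (i + m)" "(h ^^ i) z = (h ^^ m) 0" using 3(1) by (auto simp: R_def)
    obtain j l where jl: "odd (j + l)" "(h ^^ j) z = (h ^^ l) 0" using 3(2) by (auto simp: R_def)
    have "(h ^^ (j + m)) 0 = (h ^^ (j + i)) z" using im(2) by (simp add: funpow_add)
    also have "\<dots> = (h ^^ (i + l)) 0" using jl(2) by (simp add: add.commute[of j i] funpow_add)
    finally have eq: "(h ^^ (j + m)) 0 = (h ^^ (i + l)) 0" .
    have neq: "j + m \<noteq> i + l" using im(1) jl(1) by presburger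
    have "\<exists>r>0. (h ^^ r) 0 = 0"
    proof -
      have *: "\<exists>r>0. (h ^^ r) 0 = 0" if "(h ^^ a) 0 = (h ^^ b) 0" "a < b" for a b
      proof -
        have "(h ^^ a) ((h ^^ (b - a)) 0) = (h ^^ a) 0"
          using that by (simp add: funpow_add[symmetric, THEN fun_cong, unfolded o_apply])
        then have "(h ^^ (b - a)) 0 = 0" using inj_fn[OF inj, of a] by (simp add: inj_eq)
        then show ?thesis using that(2) by (intro exI[of _ "b - a"]) simp
      qed
      show ?thesis using *[OF eq] *[OF eq[symmetric]] neq nat_neq_iff by blast
    qed
    then obtain r where r: "r > 0" "(h ^^ r) 0 = 0" by blast
    let ?F = "(\<lambda>i. (h ^^ i) 0) ` {..<r}"
    have "h ` ?F \<subseteq> ?F"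
    proof
      fix x assume "x \<in> h ` ?F"
      then obtain i where i: "i < r" "x = (h ^^ Suc i) 0" by auto
      show "x \<in> ?F"
      proof (cases "Suc i = r")
        case True
        then have "x = (h ^^ 0) 0" using i r by simp
        then show ?thesis using r(1) by blast
      next
        case False
        then show ?thesis using i by (intro image_eqI[of _ _ "Suc i"]) auto
      qed
    qed
    then have F: "h ` ?F = ?F" by (intro endo_inj_surj inj_on_subset[OF inj]) auto
    have "h z \<in> ?F \<longleftrightarrow> z \<in> ?F" for z
      using inj_image_mem_iff[OF inj, of z ?F] unfolding F .
    then have "h \<in> block_stabiliser ?F" using h by (simp add: block_stabiliser_def)
    moreover have "finite ?F" by simp
    then have "?F \<noteq> UNIV" using infinite_UNIV_int by force
    moreover have "?F \<noteq> {}" using r(1) by auto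
    ultimately show ?thesis by (intro that[of ?F])
  qed
qed

definition triples :: "(int \<times> int \<times> int) list" where
  "triples = [(1, 2, 3), (1, 2, 4), (1, 2, 5), (1, 3, 4), (1, 3, 5), (1, 4, 5), (2, 3, 4),
     (2, 3, 5), (2, 4, 5), (3, 4, 5)]"

lemma distinct_triples: "(a, b, c) \<in> set triples \<Longrightarrow> distinct [a, b, c]"
  by (auto simp: triples_def)

text \<open>
  Five points on two sides: at least three of them lie on the same side.
\<close>

lemma exists_triple_on_one_side:
  obtains a b c where "(a, b, c) \<in> set triples" "{a, b, c} \<subseteq> X \<or> {a, b, c} \<inter> X = {}"
proof -
  have "\<exists>(a, b, c) \<in> set triples. {a, b, c} \<subseteq> X \<or> {a, b, c} \<inter> X = {}"
    unfolding triples_def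
    by (cases "1 \<in> X"; cases "2 \<in> X"; cases "3 \<in> X"; cases "4 \<in> X"; cases "5 \<in> X") simp_all
  then show thesis using that by auto
qed

text \<open>
  Any mate \<open>h\<close> stabilises a partition that is also stabilised by one of the ten three-cycles on
  \<open>{1, 2, 3, 4, 5}\<close>, but not by all of the group.
\<close>

lemma spread_Gn_le:
  assumes n: "n dvd 2"
  shows "spread (Gn n) \<le> 9"
proof -
  let ?G = "carrier (Gn n)"
  interpret G: int_perm_group ?G by (rule int_perm_group_Gn)
  have one: "\<one>\<^bsub>Gn n\<^esub> = id" by (simp add: Gn_def SymZ_one)
  have len: "length triples = 10" by (simp add: triples_def)
  \<comment> \<open>Indices are reduced modulo \<open>10\<close> so that every entry of the sequence is a nontrivial element.\<close>
  define g where "g i = (case triples ! (i mod 10) of (a, b, c) \<Rightarrow> cyc3 a b c)" for i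
  have mem: "triples ! (i mod 10) \<in> set triples" for i using len by simp
  have g: "g i \<in> ?G - {\<one>\<^bsub>Gn n\<^esub>}" for i
  proof -
    obtain a b c where abc: "triples ! (i mod 10) = (a, b, c)" by (cases "triples ! (i mod 10)")
    then have d: "distinct [a, b, c]" using mem[of i] distinct_triples by metis
    have "cyc3 a b c a = b" by (simp add: cyc3_def)
    then have "cyc3 a b c \<noteq> id" using d by auto
    then show ?thesis using cyc3_mem_Gn[OF n d] by (simp add: g_def abc one)
  qed
  have "k \<le> 9" if k: "\<And>g :: nat \<Rightarrow> int \<Rightarrow> int. \<forall>i<k. g i \<in> ?G - {\<one>\<^bsub>Gn n\<^esub>} \<Longrightarrow>
      \<exists>h\<in>?G. \<forall>i<k. generate (Gn n) {g i, h} = ?G" for k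
  proof (rule ccontr)
    assume "\<not> k \<le> 9"
    obtain h where h: "h \<in> ?G" "\<forall>i<k. generate (Gn n) {g i, h} = ?G" using k[of g] g by blast
    obtain X where X: "X \<noteq> {}" "X \<noteq> UNIV" "h \<in> block_stabiliser X"
      by (rule exists_block[OF G.bij[OF h(1)]])
    obtain a b c where abc: "(a, b, c) \<in> set triples" "{a, b, c} \<subseteq> X \<or> {a, b, c} \<inter> X = {}"
      by (rule exists_triple_on_one_side)
    then obtain i where i: "i < 10" "triples ! i = (a, b, c)" using len by (metis in_set_conv_nth)
    have gi: "g i = cyc3 a b c" using i by (simp add: g_def)
    have "cyc3 a b c z \<in> X \<longleftrightarrow> z \<in> X" for z using abc(2) by (auto simp: cyc3_def)
    then have "g i \<in> block_stabiliser X"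
      using bij_cyc3[OF distinct_triples[OF abc(1)]] by (simp add: gi block_stabiliser_def)
    then have "generate SymZ {g i, h} \<subseteq> block_stabiliser X"
      using X(3) int_perm_group_block_stabiliser[of X]
      by (intro group.generate_subgroup_incl[OF group_SymZ]) (auto simp: int_perm_group_def)
    moreover have "generate (Gn n) {g i, h} = generate SymZ {g i, h}"
      using g[of i] h(1) by (intro generate_Gn) auto
    ultimately have GX: "?G \<subseteq> block_stabiliser X" using h(2) i(1) \<open>\<not> k \<le> 9\<close> by auto
    obtain x y where xy: "x \<in> X" "y \<notin> X" using X by blast
    obtain z where "z \<notin> {x, y}" using ex_new_if_finite[OF infinite_UNIV_int, of "{x, y}"] by auto
    then have d: "distinct [x, y, z]" using xy by auto
    show False
      using cyc3_notin_block_stabiliser[OF xy d] cyc3_mem_Gn[OF n d] GX by blast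
  qed
  then have "enat k \<le> 9" if "\<forall>g :: nat \<Rightarrow> int \<Rightarrow> int. (\<forall>i<k. g i \<in> ?G - {\<one>\<^bsub>Gn n\<^esub>}) \<longrightarrow>
      (\<exists>h\<in>?G. \<forall>i<k. generate (Gn n) {g i, h} = ?G)" for k
    using that by (simp add: numeral_eq_enat)
  then show ?thesis
    unfolding spread_def spread_on_def by (intro Sup_least) blast
qed

lemma G1_eq: "G1 = Gn 1"
  by (simp add: G1_def Gn_def cycle123_eq translation_eq)

lemma G2_eq: "G2 = Gn 2"
proof -
  interpret group SymZ by (rule group_SymZ)
  have "translation [^]\<^bsub>SymZ\<^esub> (2::nat) = shift 2"
    by (simp add: numeral_2_eq_2 translation_eq SymZ_mult SymZ_one shift_comp)
  then show ?thesis by (simp add: G2_def Gn_def cycle123_eq)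
qed

theorem theorem6p1:
  shows "uniform_spread G1 \<ge> 2 \<and> uniform_spread G2 \<ge> 2 \<and> spread G1 \<le> 9 \<and> spread G2 \<le> 9"
  unfolding G1_eq G2_eq by (intro conjI uniform_spread_Gn spread_Gn_le) simp_all

end
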